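(* Let $G$ be a Lie group acting smoothly on $\mathbb{R}^n$, let $f:\mathbb{R}^n\to\mathbb{R}\cup\{\infty\}$ be invariant under this action (i.e. $f(gx)=f(x)$ for all $g\in G$, $x\in\mathbb{R}^n$), and let $\overline{x}\in\mathrm{dom} f$. If the action is typical at $\overline{x}$, then $$\forall v\in\partial f(y),\quad |P_{T_xGx}(v)|=O(|x-y|\,|v|)$$ for $x\in\mathrm{dom} f$ and $y\in\mathrm{dom}\,\partial f$ near $\overline{x}$, and $$\forall w\in\partial^\infty f(y),\quad |P_{T_xGx}(w)|=O(|x-y|\,|w|)$$ for $x\in\mathrm{dom} f$ and $y\in\mathrm{dom} f$ near $\overline{x}$. (That is, there are a constant $c>0$ and a neighborhood $U$ of $\overline{x}$ such that $|P_{T_xGx}(v)|\le c|x-y||v|$ for all such $x,y\in U$ and all such $v$, and likewise for $w$.)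
   Context: Smooth means $C^k$ for some fixed $k\in\{1,2,\dots,\infty\}$. $\mathrm{dom} f=\{x:f(x)<\infty\}$ and $\mathrm{dom}\,\partial f=\{x:\partial f(x)\ne\emptyset\}$; $\langle\cdot,\cdot\rangle$ and $|\cdot|$ are the Euclidean inner product and norm; neighborhoods are open; $P_V$ is the orthogonal projection onto a subspace $V$. Action: $\theta:G\times\mathbb{R}^n\to\mathbb{R}^n$, $gx=\theta(g,x)$; $e$ is the identity of $G$. The orbit $Gx=\{gx:g\in G\}$ is an immersed submanifold; with $\theta^{(x)}(g)=gx$, its tangent space at $x$ is $T_xGx=\mathrm{Im}\,d(\theta^{(x)})_e\subseteq\mathbb{R}^n$. The isotropy group is $G_x=\{g:gx=x\}$; the type of the orbit of $x$ is the conjugacy class $\tau(x)$ of $G_x$ in $G$. The action is proper near $x$ if there is a neighborhood $U$ of $x$ such that $\{g\in G:U\cap gU\neq\emptyset\}$ has compact closure. The action is typical at $x$ if it is proper near $x$ and $\tau$ is constant near $x$. Subdifferentials, at a point $\overline{x}$ where $f$ is finite (they are empty otherwise): $\widehat\partial f(\overline{x})=\{v: f(x)\ge f(\overline{x})+\langle v,x-\overline{x}\rangle+o(|x-\overline{x}|)\text{ near }\overline{x}\}$; $\partial f(\overline{x})$ is the set of $v$ for which there are $x_k$ and $v_k\in\widehat\partial f(x_k)$ with $(x_k,f(x_k),v_k)\to(\overline{x},f(\overline{x}),v)$; $\partial^\infty f(\overline{x})$ is the set of $v$ for which there are $x_k$, $v_k\in\widehat\partial f(x_k)$ and $\tau_k\searrow0$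 with $(x_k,f(x_k),\tau_kv_k)\to(\overline{x},f(\overline{x}),v)$.
   Formalization: Smooth is taken to mean C^k with k ≥ 2 (k = ∞ included); for k = 1 the claim fails, e.g. for t·(a,b) = (a+t, b+u(a+t)−u(a)) with u(s) = s√|s|, f(a,b) = b−u(a), at the origin. *)

theory Defs
  imports
    "HOL-Analysis.Analysis"
    "HOL-Library.Landau_Symbols"
    "HOL-Algebra.Group_Action"
begin

section \<open>Maps of class \<open>C\<^sup>k\<close> between finite-dimensional normed spaces\<close>

text \<open>
  For an open subset \<open>S\<close> of a finite-dimensional space, a map is of class \<open>C\<^sup>n\<^sup>+\<^sup>1\<close> on \<open>S\<close> if and
  only if it is differentiable at every point of \<open>S\<close> and each directional derivative
  \<open>x \<mapsto> Df(x)v\<close> is of class \<open>C\<^sup>n\<close> on \<open>S\<close>. The predicates are only used for such sets.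
\<close>

primrec Cn_on :: "nat \<Rightarrow> ('a::real_normed_vector \<Rightarrow> 'b::real_normed_vector) \<Rightarrow> 'a set \<Rightarrow> bool" where
  "Cn_on 0 f S \<longleftrightarrow> continuous_on S f"
| "Cn_on (Suc n) f S \<longleftrightarrow>
     (\<forall>x\<in>S. f differentiable (at x)) \<and> (\<forall>v. Cn_on n (\<lambda>x. frechet_derivative f (at x) v) S)"

definition Ck_on :: "enat \<Rightarrow> ('a::real_normed_vector \<Rightarrow> 'b::real_normed_vector) \<Rightarrow> 'a set \<Rightarrow> bool" where
  "Ck_on k f S \<longleftrightarrow> (\<forall>n. enat n \<le> k \<longrightarrow> Cn_on n f S)"


section \<open>Manifolds\<close>

text \<open>
  A chart is a pair \<open>(U, \<phi>)\<close>. The model space \<open>'e\<close> is a normed space with a finite spanning set,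
  rather than a type of class \<^class>\<open>euclidean_space\<close>, because the latter class excludes dimension
  zero and hence discrete Lie groups.
\<close>

type_synonym ('p, 'e) atlas = "('p set \<times> ('p \<Rightarrow> 'e)) set"

definition finite_dim :: "'e::real_normed_vector itself \<Rightarrow> bool" where
  "finite_dim _ \<longleftrightarrow> (\<exists>B::'e set. finite B \<and> span B = UNIV)"

definition is_chart :: "'p topology \<Rightarrow> 'p set \<times> ('p \<Rightarrow> 'e::real_normed_vector) \<Rightarrow> bool" where
  "is_chart T c \<longleftrightarrow> (case c of (U, \<phi>) \<Rightarrow>
     openin T U \<and> open (\<phi> ` U) \<and> homeomorphic_map (subtopology T U) (top_of_set (\<phi> ` U)) \<phi>)"

locale Ck_manifold =
  fixes k :: enat and T :: "'p topology" and A :: "('p, 'e::real_normed_vector) atlas"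
  assumes finite_dim: "finite_dim TYPE('e)"
    and Hausdorff: "Hausdorff_space T"
    and second_countable: "second_countable T"
    and charts: "\<And>c. c \<in> A \<Longrightarrow> is_chart T c"
    and cover: "(\<Union>c\<in>A. fst c) = topspace T"
    and compatible: "\<And>U \<phi> V \<psi>. (U, \<phi>) \<in> A \<Longrightarrow> (V, \<psi>) \<in> A \<Longrightarrow>
      Ck_on k (\<psi> \<circ> inv_into U \<phi>) (\<phi> ` (U \<inter> V))"

definition Ck_map ::
  "enat \<Rightarrow> 'p topology \<Rightarrow> ('p, 'e::real_normed_vector) atlas \<Rightarrow>
   'q topology \<Rightarrow> ('q, 'f::real_normed_vector) atlas \<Rightarrow> ('p \<Rightarrow> 'q) \<Rightarrow> bool" where
  "Ck_map k S A T B F \<longleftrightarrow> continuous_map S T F \<and>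
     (\<forall>(U, \<phi>)\<in>A. \<forall>(V, \<psi>)\<in>B. Ck_on k (\<psi> \<circ> F \<circ> inv_into U \<phi>) (\<phi> ` {p \<in> U. F p \<in> V}))"

definition prod_atlas ::
  "('p, 'e) atlas \<Rightarrow> ('q, 'f) atlas \<Rightarrow> ('p \<times> 'q, 'e \<times> 'f) atlas" where
  "prod_atlas A B = {(U \<times> V, map_prod \<phi> \<psi>) | U \<phi> V \<psi>. (U, \<phi>) \<in> A \<and> (V, \<psi>) \<in> B}"

definition std_atlas :: "('a, 'a) atlas" where
  "std_atlas = {(UNIV, id)}"

text \<open>
  The differential of \<open>F\<close> at \<open>p\<close> is expressed in one chosen chart around \<open>p\<close>, which identifies the
  tangent space at \<open>p\<close> with \<open>'e\<close>. For \<open>C\<^sup>1\<close> manifolds its range does not depend on this choice.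
\<close>

definition chart_at :: "('p, 'e) atlas \<Rightarrow> 'p \<Rightarrow> 'p set \<times> ('p \<Rightarrow> 'e)" where
  "chart_at A p = (SOME c. c \<in> A \<and> p \<in> fst c)"

definition differential ::
  "('p, 'e::real_normed_vector) atlas \<Rightarrow> ('p \<Rightarrow> 'b::real_normed_vector) \<Rightarrow> 'p \<Rightarrow> 'e \<Rightarrow> 'b" where
  "differential A F p =
     (case chart_at A p of (U, \<phi>) \<Rightarrow> frechet_derivative (F \<circ> inv_into U \<phi>) (at (\<phi> p)))"


section \<open>Lie groups and their actions\<close>

locale lie_group = group G + Ck_manifold k T A
  for k :: enat and G :: "('g, 'm) monoid_scheme" (structure)
    and T :: "'g topology" and A :: "('g, 'e::real_normed_vector) atlas" +
  assumes topspace: "topspace T = carrier G"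
    and mult_Ck: "Ck_map k (prod_topology T T) (prod_atlas A A) T A (\<lambda>(g, h). g \<otimes> h)"
    and inv_Ck: "Ck_map k T A T A (\<lambda>g. inv g)"

locale lie_group_action = lie_group k G T A + group_action G UNIV \<theta>
  for k :: enat and G :: "('g, 'm) monoid_scheme" (structure)
    and T :: "'g topology" and A :: "('g, 'e::real_normed_vector) atlas"
    and \<theta> :: "'g \<Rightarrow> 'a::euclidean_space \<Rightarrow> 'a" +
  assumes action_Ck:
    "Ck_map k (prod_topology T euclidean) (prod_atlas A std_atlas) euclidean std_atlas
       (\<lambda>(g, x). \<theta> g x)"

definition orbit_tangent ::
  "('g, 'm) monoid_scheme \<Rightarrow> ('g, 'e::real_normed_vector) atlas \<Rightarrow>
   ('g \<Rightarrow> 'a::euclidean_space \<Rightarrow> 'a) \<Rightarrow> 'a \<Rightarrow> 'a set" where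
  "orbit_tangent G A \<theta> x = range (differential A (\<lambda>g. \<theta> g x) \<one>\<^bsub>G\<^esub>)"

definition orbit_type ::
  "('g, 'm) monoid_scheme \<Rightarrow> ('g \<Rightarrow> 'a \<Rightarrow> 'a) \<Rightarrow> 'a \<Rightarrow> 'g set set" where
  "orbit_type G \<theta> x =
     {(g <#\<^bsub>G\<^esub> stabilizer G \<theta> x) #>\<^bsub>G\<^esub> (inv\<^bsub>G\<^esub> g) | g. g \<in> carrier G}"

definition proper_near ::
  "('g, 'm) monoid_scheme \<Rightarrow> 'g topology \<Rightarrow> ('g \<Rightarrow> 'a::topological_space \<Rightarrow> 'a) \<Rightarrow> 'a \<Rightarrow> bool" where
  "proper_near G T \<theta> x \<longleftrightarrow>
     (\<exists>U. open U \<and> x \<in> U \<and> compactin T (T closure_of {g \<in> carrier G. U \<inter> \<theta> g ` U \<noteq> {}}))"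

definition typical_at ::
  "('g, 'm) monoid_scheme \<Rightarrow> 'g topology \<Rightarrow> ('g \<Rightarrow> 'a::topological_space \<Rightarrow> 'a) \<Rightarrow> 'a \<Rightarrow> bool" where
  "typical_at G T \<theta> x \<longleftrightarrow>
     proper_near G T \<theta> x \<and> (\<forall>\<^sub>F y in nhds x. orbit_type G \<theta> y = orbit_type G \<theta> x)"


section \<open>Subdifferentials\<close>

definition eff_dom :: "('a \<Rightarrow> ereal) \<Rightarrow> 'a set" where
  "eff_dom f = {x. f x < \<infinity>}"

definition frechet_subdiff :: "('a::euclidean_space \<Rightarrow> ereal) \<Rightarrow> 'a \<Rightarrow> 'a set" where
  "frechet_subdiff f x = {v. \<bar>f x\<bar> \<noteq> \<infinity> \<and>
     (\<exists>r :: 'a \<Rightarrow> real. r \<in> o[nhds x](\<lambda>y. norm (y - x)) \<and>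
        (\<forall>\<^sub>F y in nhds x. f y \<ge> f x + ereal (v \<bullet> (y - x) + r y)))}"

definition subdiff :: "('a::euclidean_space \<Rightarrow> ereal) \<Rightarrow> 'a \<Rightarrow> 'a set" where
  "subdiff f x = {v. \<bar>f x\<bar> \<noteq> \<infinity> \<and>
     (\<exists>X V. (\<forall>i::nat. V i \<in> frechet_subdiff f (X i)) \<and>
        X \<longlonglongrightarrow> x \<and> (\<lambda>i. f (X i)) \<longlonglongrightarrow> f x \<and> V \<longlonglongrightarrow> v)}"

definition horizon_subdiff :: "('a::euclidean_space \<Rightarrow> ereal) \<Rightarrow> 'a \<Rightarrow> 'a set" where
  "horizon_subdiff f x = {v. \<bar>f x\<bar> \<noteq> \<infinity> \<and>
     (\<exists>X V \<tau>. (\<forall>i::nat. V i \<in> frechet_subdiff f (X i)) \<and>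
        (\<forall>i. \<tau> i > (0::real)) \<and> decseq \<tau> \<and> \<tau> \<longlonglongrightarrow> 0 \<and>
        X \<longlonglongrightarrow> x \<and> (\<lambda>i. f (X i)) \<longlonglongrightarrow> f x \<and> (\<lambda>i. \<tau> i *\<^sub>R V i) \<longlonglongrightarrow> v)}"

definition subdiff_dom :: "('a::euclidean_space \<Rightarrow> ereal) \<Rightarrow> 'a set" where
  "subdiff_dom f = {x. subdiff f x \<noteq> {}}"


section \<open>Orthogonal projection onto a subspace\<close>

definition orth_proj :: "'a::euclidean_space set \<Rightarrow> 'a \<Rightarrow> 'a" where
  "orth_proj V v = (THE p. p \<in> V \<and> (\<forall>u\<in>V. orthogonal (v - p) u))"

end

theory Submission
  imports Defs
begin

text \<open>
  Write \<open>L x\<close> for the differential at the identity of the orbit map \<open>g \<mapsto> \<theta> g x\<close>, so that the tangent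
  space of the orbit of \<open>x\<close> is the range of \<open>L x\<close>. Three facts combine.

  First, \<open>f\<close> is constant on orbits, so its regular subgradients at a point are orthogonal to the orbit
  through that point; as \<open>L y\<close> depends continuously on \<open>y\<close>, so are limiting and horizon subgradients
  (\<open>subgradient_orthogonal_orbit\<close>). Thus \<open>v \<bullet> L y u = 0\<close> for all \<open>u\<close>, for each of the vectors in question.

  Second, the rank of \<open>L x\<close> does not exceed the rank of \<open>L xbar\<close> for \<open>x\<close> near \<open>xbar\<close>, because it only
  depends on the orbit type (\<open>rank_le_if_orbit_type_eq\<close>). The point is that the kernel of \<open>L x\<close>, the
  Lie algebra of the isotropy group, can be recovered from the isotropy group as an abstract subgroup:
  it consists of the velocities of curves in it. Instead of the exponential map, which would require
  solving an ordinary differential equation, the proof uses that orbit maps have constant rank by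
  equivariance, and that the fibres of a map of constant rank contain curves in every kernel direction
  (\<open>constant_rank_fibre_curve\<close>, from the inverse function theorem).

  Third, since the action is of class \<open>C\<^sup>2\<close>, \<open>x \<mapsto> L x u\<close> is locally Lipschitz, and by the bound on the
  rank the tangent spaces near \<open>xbar\<close> have bases that depend on the point in a Lipschitz way and stay
  uniformly independent. A vector orthogonal to the tangent space at \<open>y\<close> is then orthogonal to that at
  \<open>x\<close> up to an error of order \<open>|x - y|\<close> (\<open>orth_proj_Lipschitz_estimate\<close>).
\<close>

section \<open>Linear algebra\<close>

lemma orth_proj_subspace:
  fixes V :: "'a::euclidean_space set"
  assumes V: "subspace V"
  shows "orth_proj V v \<in> V \<and> (\<forall>u\<in>V. orthogonal (v - orth_proj V v) u)"
  unfolding orth_proj_def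
proof (rule theI')
  have sp: "span V = V"
    using V by (simp add: span_eq_iff)
  obtain y z where yz: "y \<in> span V" "\<And>w. w \<in> span V \<Longrightarrow> orthogonal z w" "v = y + z"
    by (rule orthogonal_subspace_decomp_exists[of V v]) blast
  show "\<exists>!p. p \<in> V \<and> (\<forall>u\<in>V. orthogonal (v - p) u)"
  proof (rule ex1I[of _ y])
    show "y \<in> V \<and> (\<forall>u\<in>V. orthogonal (v - y) u)"
      using yz sp by auto
  next
    fix p assume p: "p \<in> V \<and> (\<forall>u\<in>V. orthogonal (v - p) u)"
    have d: "p - y \<in> V"
      using p yz(1) sp V by (auto intro: subspace_diff)
    have "orthogonal (v - p) (p - y)" "orthogonal z (p - y)"
      using p d yz(2) sp by auto
    then have "(p - y) \<bullet> (p - y) = 0"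
      using yz(3) by (simp add: orthogonal_def algebra_simps inner_commute)
    then show "p = y" by simp
  qed
qed

lemma linear_right_inverse_on_range:
  fixes L :: "'a::real_vector \<Rightarrow> 'b::euclidean_space"
  assumes "linear L"
  obtains M where "linear M" "\<And>u. L (M (L u)) = L u"
  using linear_exists_right_inverse_on[OF assms subspace_UNIV] by blast

text \<open>
  If \<open>ker L \<subseteq> ker L'\<close>, then \<open>L'\<close> factors through \<open>L\<close>. The common domain is only a real vector
  space, so the ranks are compared through this factorization and not through rank-nullity.
\<close>

lemma dim_range_le_if_kernel_le:
  fixes L :: "'e::real_vector \<Rightarrow> 'a::euclidean_space" and L' :: "'e \<Rightarrow> 'b::euclidean_space"
  assumes L: "linear L" and L': "linear L'"
    and ker: "\<And>u. L u = 0 \<Longrightarrow> L' u = 0"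
  shows "dim (range L') \<le> dim (range L)"
proof -
  obtain M where M: "linear M" "\<And>u. L (M (L u)) = L u"
    using linear_right_inverse_on_range[OF L] by blast
  have "L' u = (L' \<circ> M) (L u)" for u
  proof -
    have "L (u - M (L u)) = 0"
      using M(2) by (simp add: linear_diff[OF L])
    then have "L' (u - M (L u)) = 0" by (rule ker)
    then show ?thesis by (simp add: linear_diff[OF L'])
  qed
  then have "range L' = (L' \<circ> M) ` range L" by force
  then show ?thesis
    using dim_image_le[OF linear_compose[OF M(1) L'], of "range L"] by simp
qed

lemma kernel_trivial_if_dim_image_ge:
  fixes \<pi> :: "'a::euclidean_space \<Rightarrow> 'b::euclidean_space"
  assumes "linear \<pi>" "subspace R" "dim R \<le> dim (\<pi> ` R)" "u \<in> R" "\<pi> u = 0"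
  shows "u = 0"
proof -
  obtain h where h: "range h \<subseteq> R" "linear h" "\<And>v. v \<in> \<pi> ` R \<Longrightarrow> \<pi> (h v) = v"
    using linear_exists_right_inverse_on[OF assms(1,2)] by blast
  have inj: "inj_on h (\<pi> ` R)"
    by (metis h(3) inj_onI)
  have sub: "subspace (\<pi> ` R)"
    using assms(1,2) by (simp add: linear_subspace_image)
  have "dim (h ` \<pi> ` R) = dim (\<pi> ` R)"
    using inj sub h(2) by (intro dim_image_eq) (auto simp: span_eq_iff[THEN iffD2])
  moreover have "h ` \<pi> ` R \<subseteq> R" using h(1) by blast
  ultimately have "h ` \<pi> ` R = R"
    using subspace_dim_equal[of "h ` \<pi> ` R" R] assms sub h(2) linear_subspace_image by auto
  then obtain w where "w \<in> \<pi> ` R" "u = h w" using assms(4) by auto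
  then show ?thesis using h assms(5) by (metis linear_0)
qed

section \<open>Calculus of \<open>C\<^sup>1\<close> maps\<close>

text \<open>
  The predicate \<^const>\<open>Cn_on\<close> speaks of continuous directional derivatives, whereas the inverse function
  theorem and the Lipschitz estimate below use derivatives that are continuous in the operator norm.
  On a Euclidean domain this is the same, since finitely many directions determine the operator.
\<close>

lemma C1_imp_continuous_blinfun_derivative:
  fixes F' :: "'d::t2_space \<Rightarrow> 'a::euclidean_space \<Rightarrow> 'b::real_normed_vector"
  assumes "\<And>x. x \<in> S \<Longrightarrow> bounded_linear (F' x)" "\<And>v. continuous_on S (\<lambda>x. F' x v)"
  shows "continuous_on S (\<lambda>x. Blinfun (F' x))"
proof (rule continuous_on_blinfun_componentwise)
  fix i :: 'a
  show "continuous_on S (\<lambda>x. blinfun_apply (Blinfun (F' x)) i)"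
    using assms(2)[of i] by (rule continuous_on_eq) (simp add: bounded_linear_Blinfun_apply assms(1))
qed

lemma C1_locally_Lipschitz:
  fixes q :: "'a::euclidean_space \<Rightarrow> 'b::real_normed_vector"
  assumes S: "open S" "x0 \<in> S"
    and der: "\<And>x. x \<in> S \<Longrightarrow> (q has_derivative q' x) (at x)"
    and cont: "\<And>v. continuous_on S (\<lambda>x. q' x v)"
  obtains C d where "0 < d" "ball x0 d \<subseteq> S"
    "\<And>x y. x \<in> ball x0 d \<Longrightarrow> y \<in> ball x0 d \<Longrightarrow> norm (q x - q y) \<le> C * norm (x - y)"
proof -
  have bl: "\<And>x. x \<in> S \<Longrightarrow> bounded_linear (q' x)"
    using der has_derivative_bounded_linear by blast
  let ?D = "\<lambda>x. Blinfun (q' x)"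
  have "continuous_on S ?D"
    using C1_imp_continuous_blinfun_derivative[OF bl cont] by blast
  then have "continuous (at x0) ?D"
    using S continuous_on_eq_continuous_at by blast
  then obtain d1 where d1: "0 < d1" "\<And>x. dist x x0 < d1 \<Longrightarrow> dist (?D x) (?D x0) < 1"
    unfolding continuous_at_eps_delta using zero_less_one by (metis dist_commute)
  obtain d2 where d2: "0 < d2" "ball x0 d2 \<subseteq> S"
    using S openE by blast
  define d where "d = min d1 d2"
  have sub: "ball x0 d \<subseteq> S" using d2 by (auto simp: d_def)
  have on: "onorm (q' x) \<le> norm (?D x0) + 1" if "x \<in> ball x0 d" for x
  proof -
    have "onorm (q' x) = norm (?D x)"
      using bl sub that by (simp add: norm_blinfun.rep_eq bounded_linear_Blinfun_apply subset_iff)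
    also have "\<dots> \<le> norm (?D x0) + norm (?D x - ?D x0)"
      by (metis add.commute diff_add_cancel norm_triangle_ineq)
    also have "norm (?D x - ?D x0) \<le> 1"
      using d1(2)[of x] that by (auto simp: d_def dist_norm norm_minus_commute)
    finally show ?thesis by simp
  qed
  show ?thesis
  proof (rule that[of d "norm (?D x0) + 1"])
    show "0 < d" using d1 d2 by (simp add: d_def)
    show "ball x0 d \<subseteq> S" by fact
    show "norm (q x - q y) \<le> (norm (?D x0) + 1) * norm (x - y)"
      if "x \<in> ball x0 d" "y \<in> ball x0 d" for x y
      using that on sub
      by (intro differentiable_bound[of "ball x0 d" q q']) (auto intro!: has_derivative_at_withinI der)
  qed
qed

text \<open>
  The part of the constant rank theorem that is needed below: every vector in the kernel of the
  derivative at \<open>p0\<close> is the velocity of a curve in the fibre through \<open>p0\<close>. With \<open>\<pi>\<close> a linear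
  projection onto the range \<open>W\<close> of \<open>F' p0\<close>, the composition \<open>\<pi> \<circ> F\<close> is a submersion at \<open>p0\<close>, so the
  inverse function theorem gives a curve along which \<open>\<pi> \<circ> F\<close> is constant. Near \<open>p0\<close> the derivative
  \<open>F' p\<close> has rank at most \<open>dim W\<close>, while \<open>\<pi> \<circ> F' p\<close> still maps onto \<open>W\<close>; hence \<open>\<pi>\<close> is injective on the
  range of \<open>F' p\<close>, and constancy of \<open>\<pi> \<circ> F\<close> along the curve forces constancy of \<open>F\<close>.

  The space \<open>'e\<close> of parameters need not be Euclidean. The equation is therefore solved for a
  correction \<open>s\<close> in the Euclidean space \<open>'a\<close>, which enters the curve \<open>p0 + t E + M s\<close> through a right
  inverse \<open>M\<close> of \<open>F' p0\<close> on \<open>W\<close>.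
\<close>

lemma constant_rank_fibre_curve:
  fixes F :: "'e::real_normed_vector \<Rightarrow> 'a::euclidean_space"
  assumes S: "open S" "p0 \<in> S"
    and der: "\<And>p. p \<in> S \<Longrightarrow> (F has_derivative F' p) (at p)"
    and cont: "\<And>v. continuous_on S (\<lambda>p. F' p v)"
    and rank: "\<And>p. p \<in> S \<Longrightarrow> dim (range (F' p)) \<le> dim (range (F' p0))"
    and E: "F' p0 E = 0"
  obtains c where "c 0 = p0" "(c has_vector_derivative E) (at 0)"
    "\<forall>\<^sub>F t in nhds (0::real). c t \<in> S \<and> F (c t) = F p0"
proof -
  let ?W = "range (F' p0)"
  have bl: "\<And>p. p \<in> S \<Longrightarrow> bounded_linear (F' p)"
    using der has_derivative_bounded_linear by blast
  then have lin: "\<And>p. p \<in> S \<Longrightarrow> linear (F' p)"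
    using bounded_linear.linear by blast
  have sW: "subspace ?W"
    using lin[OF S(2)] by (simp add: linear_subspace_image)
  obtain \<pi> :: "'a \<Rightarrow> 'a" where \<pi>: "linear \<pi>" "range \<pi> \<subseteq> ?W" "\<And>w. w \<in> ?W \<Longrightarrow> \<pi> w = w"
    using linear_exists_left_inverse_on[OF linear_id sW] by auto
  have \<pi>\<pi>: "\<pi> (\<pi> s) = \<pi> s" for s
    using \<pi>(2,3) by blast
  obtain M0 where M0: "linear M0" "\<And>u. F' p0 (M0 (F' p0 u)) = F' p0 u"
    using linear_right_inverse_on_range[OF lin[OF S(2)]] by blast
  \<comment> \<open>Precomposing with \<open>\<pi>\<close> makes \<open>F' p0 \<circ> M\<close> equal to \<open>\<pi>\<close> on the whole space, not only on \<open>W\<close>.\<close>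
  define M where "M = M0 \<circ> \<pi>"
  have lM: "linear M" unfolding M_def using \<pi>(1) M0(1) by (rule linear_compose)
  have blM: "bounded_linear M" using lM by (simp add: linear_linear)
  have bl\<pi>: "bounded_linear \<pi>" using \<pi>(1) by (simp add: linear_linear)
  have LM: "F' p0 (M s) = \<pi> s" for s
  proof -
    obtain u where "\<pi> s = F' p0 u" using \<pi>(2) by blast
    then show ?thesis by (simp add: M_def M0(2))
  qed
  define a :: "real \<times> 'a \<Rightarrow> 'e" where "a z = p0 + fst z *\<^sub>R E + M (snd z)" for z
  define a' :: "real \<times> 'a \<Rightarrow> 'e" where "a' z = fst z *\<^sub>R E + M (snd z)" for z
  have da: "(a has_derivative a') (at z)" for z
  proof -
    have "((\<lambda>z :: real \<times> 'a. M (snd z)) has_derivative (\<lambda>h. M (snd h))) (at z)"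
      by (intro bounded_linear.has_derivative[OF blM] has_derivative_snd has_derivative_ident)
    then show ?thesis
      unfolding a_def a'_def by (auto intro!: derivative_eq_intros)
  qed
  have ca: "continuous_on X a" for X
    by (rule has_derivative_continuous_on) (rule has_derivative_at_withinI[OF da])
  define S' where "S' = a -` S"
  have oS': "open S'" unfolding S'_def using S(1) ca open_vimage by blast
  have zS': "(0, 0) \<in> S'" using S(2) linear_0[OF lM] by (simp add: S'_def a_def)
  \<comment> \<open>The first component keeps the time \<open>t\<close>. The summand \<open>s - \<pi> s\<close> fills the complement of \<open>W\<close>,
    so that the derivative of \<open>\<Psi>\<close> at the origin is the identity.\<close>
  define \<Psi> where "\<Psi> z = (fst z, \<pi> (F (a z)) + snd z - \<pi> (snd z))" for z
  define \<Psi>' where "\<Psi>' z h = (fst h, \<pi> (F' (a z) (a' h)) + snd h - \<pi> (snd h))" for z h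
  have d\<Psi>: "(\<Psi> has_derivative \<Psi>' z) (at z)" if "z \<in> S'" for z
  proof -
    have "((F \<circ> a) has_derivative (F' (a z) \<circ> a')) (at z)"
      using that der da by (intro diff_chain_at) (auto simp: S'_def)
    from bounded_linear.has_derivative[OF bl\<pi> this]
    have "((\<lambda>z. \<pi> (F (a z))) has_derivative (\<lambda>h. \<pi> (F' (a z) (a' h)))) (at z)"
      by (simp add: o_def)
    moreover have "((\<lambda>z :: real \<times> 'a. \<pi> (snd z)) has_derivative (\<lambda>h. \<pi> (snd h))) (at z)"
      by (intro bounded_linear.has_derivative[OF bl\<pi>] has_derivative_snd has_derivative_ident)
    ultimately show ?thesis
      unfolding \<Psi>_def \<Psi>'_def
      by (intro has_derivative_Pair has_derivative_diff has_derivative_add has_derivative_fst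
          has_derivative_snd has_derivative_ident)
  qed
  then have bl\<Psi>: "\<And>z. z \<in> S' \<Longrightarrow> bounded_linear (\<Psi>' z)"
    using has_derivative_bounded_linear by blast
  have c\<Psi>: "continuous_on S' (\<lambda>z. Blinfun (\<Psi>' z))"
  proof (rule C1_imp_continuous_blinfun_derivative[OF bl\<Psi>])
    fix h :: "real \<times> 'a"
    have "continuous_on S' (\<lambda>z. F' (a z) (a' h))"
      using continuous_on_compose2[OF cont ca, of S'] by (auto simp: S'_def)
    then have "continuous_on S' (\<lambda>z. \<pi> (F' (a z) (a' h)))"
      by (rule bounded_linear.continuous_on[OF bl\<pi>])
    then show "continuous_on S' (\<lambda>z. \<Psi>' z h)"
      unfolding \<Psi>'_def by (intro continuous_intros)
  qed
  have az: "a (0, 0) = p0" by (simp add: a_def linear_0[OF lM])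
  have id: "\<Psi>' (0, 0) = id"
  proof
    fix h :: "real \<times> 'a"
    have "F' p0 (a' h) = \<pi> (snd h)"
      using E LM lin[OF S(2)] by (simp add: a'_def linear_add linear_scale)
    then show "\<Psi>' (0, 0) h = id h"
      by (simp add: \<Psi>'_def az \<pi>\<pi>)
  qed
  obtain U V g g' where UV: "open U" "U \<subseteq> S'" "(0, 0) \<in> U" "open V" "\<Psi> (0, 0) \<in> V"
    and hom: "homeomorphism U V \<Psi> g"
    and dg: "\<And>y. y \<in> V \<Longrightarrow> (g has_derivative g' y) (at y)"
    and g': "\<And>y. y \<in> V \<Longrightarrow> g' y = inv_into UNIV (blinfun_apply (Blinfun (\<Psi>' (g y))))"
    and bij: "\<And>y. y \<in> V \<Longrightarrow> bij (blinfun_apply (Blinfun (\<Psi>' (g y))))"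
  proof (rule inverse_function_theorem[OF oS' _ c\<Psi> zS', of \<Psi> id_blinfun])
    show "(\<Psi> has_derivative blinfun_apply (Blinfun (\<Psi>' z))) (at z)" if "z \<in> S'" for z
      using d\<Psi>[OF that] bl\<Psi>[OF that] by (simp add: bounded_linear_Blinfun_apply)
    show "id_blinfun o\<^sub>L Blinfun (\<Psi>' (0, 0)) = id_blinfun"
      using bl\<Psi>[OF zS'] by (intro blinfun_eqI) (simp add: bounded_linear_Blinfun_apply id)
  qed blast
  have gU: "g y \<in> U" "\<Psi> (g y) = y" if "y \<in> V" for y
    using hom that by (auto simp: homeomorphism_def)
  have gS: "a (g y) \<in> S" if "y \<in> V" for y
    using gU(1)[OF that] UV(2) by (auto simp: S'_def)
  have apply_Blinfun: "blinfun_apply (Blinfun (\<Psi>' (g y))) = \<Psi>' (g y)" if "y \<in> V" for y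
    using bl\<Psi> gU(1)[OF that] UV(2) by (intro bounded_linear_Blinfun_apply) blast
  have g'eq: "g' y = inv_into UNIV (\<Psi>' (g y))" and bij\<Psi>: "bij (\<Psi>' (g y))" if "y \<in> V" for y
    using g'[OF that] bij[OF that] by (simp_all add: apply_Blinfun that)
  \<comment> \<open>The curve is the preimage under \<open>\<Psi>\<close> of the line on which the second component keeps its initial
    value; applying \<open>\<pi>\<close> to that component shows that \<open>\<pi> \<circ> F\<close> is constant on the curve.\<close>
  define s where "s = \<pi> (F p0)"
  define j where "j t = (t, s)" for t :: real
  have \<Psi>0: "\<Psi> (0, 0) = j 0"
    by (simp add: \<Psi>_def az j_def s_def linear_0[OF \<pi>(1)])
  define c where "c t = a (g (j t))" for t
  have dj: "(j has_derivative (\<lambda>h. (h, 0))) (at t)" for t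
    unfolding j_def by (auto intro!: derivative_eq_intros)
  have oJ: "open (j -` V)"
    by (intro open_vimage UV(4)) (auto simp: j_def intro!: continuous_intros)
  have "0 \<in> j -` V" using UV(5) \<Psi>0 by simp
  then obtain \<delta> where \<delta>: "0 < \<delta>" "ball 0 \<delta> \<subseteq> j -` V"
    using oJ openE by blast
  have jV: "j t \<in> V" if "t \<in> ball 0 \<delta>" for t using \<delta> that by auto
  have dc: "(c has_derivative (\<lambda>h. a' (g' (j t) (h, 0)))) (at t)" if "t \<in> ball 0 \<delta>" for t
  proof -
    have "(g \<circ> j has_derivative g' (j t) \<circ> (\<lambda>h. (h, 0))) (at t)"
      by (intro diff_chain_at dj dg jV that)
    then have "(a \<circ> (g \<circ> j) has_derivative a' \<circ> (g' (j t) \<circ> (\<lambda>h. (h, 0)))) (at t)"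
      by (rule diff_chain_at) (rule da)
    then show ?thesis by (simp add: o_def c_def[abs_def])
  qed
  have gj0: "g (j 0) = (0, 0)"
    using hom UV(3) \<Psi>0 by (metis homeomorphism_def)
  have c0: "c 0 = p0" by (simp add: c_def gj0 az)
  have \<pi>Fc: "\<pi> (F (c t)) = s" if "t \<in> ball 0 \<delta>" for t
  proof -
    have "\<Psi> (g (j t)) = j t" using gU jV that by blast
    then have "\<pi> (F (c t)) + snd (g (j t)) - \<pi> (snd (g (j t))) = s"
      by (simp add: \<Psi>_def j_def c_def)
    then have "\<pi> (\<pi> (F (c t)) + snd (g (j t)) - \<pi> (snd (g (j t)))) = \<pi> s" by simp
    then show ?thesis
      using \<pi>(1) by (simp add: linear_add linear_diff \<pi>\<pi> s_def)
  qed
  have inj: "u = 0" if t: "t \<in> ball 0 \<delta>" and u: "u \<in> range (F' (c t))" "\<pi> u = 0" for t u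
  proof (rule kernel_trivial_if_dim_image_ge[OF \<pi>(1) _ _ u])
    have cS: "c t \<in> S" using gS jV t by (simp add: c_def)
    show "subspace (range (F' (c t)))" using lin[OF cS] by (simp add: linear_subspace_image)
    have "?W \<subseteq> \<pi> ` range (F' (c t))"
    proof
      fix w assume w: "w \<in> ?W"
      \<comment> \<open>Invertibility of \<open>\<Psi>'\<close> at the point of the curve gives surjectivity of \<open>\<pi> \<circ> F'\<close> onto \<open>W\<close> there.\<close>
      obtain h where h: "(0, w) = \<Psi>' (g (j t)) h"
        using bij\<Psi>[OF jV[OF t]] by (metis bij_pointE)
      then have "w = \<pi> (F' (c t) (a' h)) + snd h - \<pi> (snd h)"
        by (simp add: \<Psi>'_def c_def)
      then have "\<pi> w = \<pi> (F' (c t) (a' h))"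
        using \<pi>(1) by (simp add: linear_add linear_diff \<pi>\<pi>)
      then show "w \<in> \<pi> ` range (F' (c t))" using \<pi>(3)[OF w] by auto
    qed
    then have "dim ?W \<le> dim (\<pi> ` range (F' (c t)))" by (rule dim_subset)
    then show "dim (range (F' (c t))) \<le> dim (\<pi> ` range (F' (c t)))"
      using rank[OF cS] by simp
  qed
  have dFc: "((\<lambda>t. F (c t)) has_derivative (\<lambda>h. 0)) (at t)" if t: "t \<in> ball 0 \<delta>" for t
  proof -
    let ?D = "\<lambda>h. F' (c t) (a' (g' (j t) (h, 0)))"
    have cS: "c t \<in> S" using gS jV t by (simp add: c_def)
    have D: "((\<lambda>t. F (c t)) has_derivative ?D) (at t)"
      using diff_chain_at[OF dc[OF t] der[OF cS]] by (simp add: o_def)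
    have "((\<lambda>t. \<pi> (F (c t))) has_derivative (\<lambda>h. \<pi> (?D h))) (at t)"
      by (rule bounded_linear.has_derivative[OF bl\<pi> D])
    moreover have "((\<lambda>t. \<pi> (F (c t))) has_derivative (\<lambda>h. 0)) (at t)"
      by (rule has_derivative_transform_within_open[OF has_derivative_const[of s] open_ball t])
        (simp add: \<pi>Fc)
    ultimately have "(\<lambda>h. \<pi> (?D h)) = (\<lambda>h. 0)"
      by (rule has_derivative_unique)
    then have "?D = (\<lambda>h. 0)"
      using inj[OF t] by (metis rangeI)
    then show ?thesis using D by simp
  qed
  have const: "F (c t) = F p0" if "t \<in> ball 0 \<delta>" for t
    using has_derivative_zero_unique_connected[OF open_ball connected_ball dFc that, of 0] \<delta>(1) c0
    by simp
  show ?thesis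
  proof (rule that[of c, OF c0])
    have "g' (j 0) = id"
      using g'eq[OF jV[of 0]] \<delta>(1) by (simp add: gj0 id)
    then have "(c has_derivative (\<lambda>h. a' (h, 0))) (at 0)"
      using dc[of 0] \<delta>(1) by simp
    then show "(c has_vector_derivative E) (at 0)"
      unfolding has_vector_derivative_def by (simp add: a'_def linear_0[OF lM])
    show "\<forall>\<^sub>F t in nhds 0. c t \<in> S \<and> F (c t) = F p0"
      unfolding eventually_nhds using \<delta>(1) const gS jV
      by (intro exI[of _ "ball 0 \<delta>"]) (auto simp: c_def)
  qed
qed

section \<open>Subgradients and curves in level sets\<close>

text \<open>
  Along a curve on which \<open>f\<close> is constant, the affine minorant plus its error \<open>r\<close> has a local maximum
  at the base point, so its derivative \<open>v \<bullet> \<xi>\<close> vanishes there.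
\<close>

lemma frechet_subdiff_orthogonal_curve:
  fixes f :: "'a::euclidean_space \<Rightarrow> ereal"
  assumes v: "v \<in> frechet_subdiff f y"
    and c0: "c 0 = y" and dc: "(c has_vector_derivative \<xi>) (at 0)"
    and const: "\<forall>\<^sub>F t in at (0::real). f (c t) = f y"
  shows "v \<bullet> \<xi> = 0"
proof -
  obtain r where fin: "\<bar>f y\<bar> \<noteq> \<infinity>" and r: "r \<in> o[nhds y](\<lambda>z. norm (z - y))"
    and ge: "\<forall>\<^sub>F z in nhds y. f z \<ge> f y + ereal (v \<bullet> (z - y) + r z)"
    using v by (auto simp: frechet_subdiff_def)
  have r0: "r y = 0"
    using eventually_nhds_x_imp_x[OF landau_o.smallD[OF r zero_less_one]] by simp
  have dr: "(r has_derivative (\<lambda>h. 0)) (at y)"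
    unfolding has_derivative_iff_norm
  proof (intro conjI bounded_linear_zero)
    have "((\<lambda>z. norm (r z) / norm (z - y)) \<longlongrightarrow> 0) (at y)"
    proof (rule tendstoI)
      fix e :: real assume e: "0 < e"
      have "\<forall>\<^sub>F z in nhds y. norm (r z) \<le> e / 2 * norm (z - y)"
        using landau_o.smallD[OF r, of "e / 2"] e by simp
      then have "\<forall>\<^sub>F z in at y. norm (r z) \<le> e / 2 * norm (z - y)"
        by (rule eventually_nhds_conv_at[THEN iffD1, THEN conjunct1])
      moreover have "\<forall>\<^sub>F z in at y. z \<noteq> y"
        by (simp add: eventually_at_filter)
      ultimately show "\<forall>\<^sub>F z in at y. dist (norm (r z) / norm (z - y)) 0 < e"
      proof eventually_elim
        case (elim z)
        then have "norm (r z) / norm (z - y) \<le> e / 2" by (simp add: divide_le_eq)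
        moreover have "dist (norm (r z) / norm (z - y)) 0 = norm (r z) / norm (z - y)"
          by (simp add: dist_real_def)
        ultimately show ?case using e by linarith
      qed
    qed
    then show "((\<lambda>z. norm (r z - r y - 0) / norm (z - y)) \<longlongrightarrow> 0) (at y)"
      by (simp add: r0)
  qed
  let ?h = "\<lambda>t. v \<bullet> (c t - y) + r (c t)"
  have dc': "(c has_derivative (\<lambda>t. t *\<^sub>R \<xi>)) (at 0)"
    using dc by (simp add: has_vector_derivative_def)
  have "((\<lambda>t. r (c t)) has_derivative (\<lambda>t. 0)) (at 0)"
    using diff_chain_at[OF dc', of r "\<lambda>h. 0"] dr c0 by (simp add: o_def)
  then have dh: "(?h has_derivative (\<lambda>t. v \<bullet> (t *\<^sub>R \<xi>))) (at 0)"
    using dc' by (auto intro!: derivative_eq_intros)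
  have "(c \<longlongrightarrow> y) (at 0)"
    using has_derivative_continuous[OF dc'] c0 by (simp add: continuous_at)
  then have "\<forall>\<^sub>F t in at 0. f (c t) \<ge> f y + ereal (?h t)"
    using ge filterlim_iff by blast
  with const have "\<forall>\<^sub>F t in at 0. ?h t \<le> ?h 0"
  proof eventually_elim
    case (elim t)
    then have "f y + ereal (?h t) \<le> f y" by simp
    then have "?h t \<le> 0" using fin by (cases "f y") auto
    then show ?case by (simp add: c0 r0)
  qed
  then have "(\<lambda>t. v \<bullet> (t *\<^sub>R \<xi>)) = (\<lambda>t. 0)"
    by (rule has_derivative_local_max[OF dh])
  from fun_cong[OF this, of 1] show ?thesis by simp
qed

text \<open>
  Orthogonality to a continuous vector field passes to limits of subgradients, scaled or not.
\<close>

lemma limiting_subgradient_orthogonal: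
  fixes f :: "'a::euclidean_space \<Rightarrow> ereal"
  assumes orth: "\<And>z v. v \<in> frechet_subdiff f z \<Longrightarrow> v \<bullet> \<xi> z = 0"
    and cont: "isCont \<xi> y"
    and v: "v \<in> subdiff f y \<union> horizon_subdiff f y"
  shows "v \<bullet> \<xi> y = 0"
proof -
  obtain X V \<tau> where V: "\<And>i::nat. V i \<in> frechet_subdiff f (X i)"
    and X: "X \<longlonglongrightarrow> y" and \<tau>: "(\<lambda>i. (\<tau> i :: real) *\<^sub>R V i) \<longlonglongrightarrow> v"
  proof -
    consider "v \<in> subdiff f y" | "v \<in> horizon_subdiff f y" using v by blast
    then show ?thesis
    proof cases
      case 1
      then obtain X V where "\<forall>i::nat. V i \<in> frechet_subdiff f (X i)" "X \<longlonglongrightarrow> y" "V \<longlonglongrightarrow> v"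
        unfolding subdiff_def by blast
      \<comment> \<open>A limiting subgradient is treated as a horizon subgradient with the scaling factor one.\<close>
      then show ?thesis using that[of V X "\<lambda>_. 1"] by simp
    next
      case 2
      then obtain X V \<tau> where "\<forall>i::nat. V i \<in> frechet_subdiff f (X i)" "X \<longlonglongrightarrow> y"
        "(\<lambda>i. (\<tau> i :: real) *\<^sub>R V i) \<longlonglongrightarrow> v"
        unfolding horizon_subdiff_def by blast
      then show ?thesis using that[of V X \<tau>] by simp
    qed
  qed
  have "(\<lambda>i. (\<tau> i *\<^sub>R V i) \<bullet> \<xi> (X i)) \<longlonglongrightarrow> v \<bullet> \<xi> y"
    by (intro tendsto_inner \<tau> isCont_tendsto_compose[OF cont X])
  moreover have "(\<tau> i *\<^sub>R V i) \<bullet> \<xi> (X i) = 0" for i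
    using orth[OF V] by simp
  ultimately have "(\<lambda>i::nat. 0::real) \<longlonglongrightarrow> v \<bullet> \<xi> y" by (simp only:)
  then show ?thesis by (simp add: LIMSEQ_const_iff)
qed

section \<open>Projections onto ranges of constant rank\<close>

text \<open>
  A point of the range of \<open>L x\<close> is \<open>L x u\<close> with \<open>u\<close> controlled by its norm, uniformly for \<open>x\<close> near \<open>x0\<close>;
  this is where the bound on the rank enters. If \<open>v\<close> is orthogonal to the range of \<open>L y\<close>, the
  projection \<open>p = L x u\<close> of \<open>v\<close> onto the range of \<open>L x\<close> satisfies
  \<open>|p|\<^sup>2 = v \<bullet> L x u = v \<bullet> (L x u - L y u)\<close>, which is at most a multiple of \<open>|v| |x - y| |p|\<close>.

  To obtain the control, \<open>L x\<close> is composed with a right inverse \<open>M\<close> of \<open>L x0\<close> on its range \<open>W\<close>: the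
  maps \<open>L x \<circ> M\<close> act on a Euclidean space and are close to the identity on \<open>W\<close>.
\<close>

lemma orth_proj_Lipschitz_estimate:
  fixes L :: "'p::metric_space \<Rightarrow> 'e::real_normed_vector \<Rightarrow> 'a::euclidean_space"
  assumes lin: "\<And>x. linear (L x)"
    and Lip: "\<And>u. \<exists>C d. 0 < d \<and>
      (\<forall>x\<in>ball x0 d. \<forall>y\<in>ball x0 d. norm (L x u - L y u) \<le> C * dist x y)"
    and rank: "\<forall>\<^sub>F x in nhds x0. dim (range (L x)) \<le> dim (range (L x0))"
  obtains c U where "0 < c" "open U" "x0 \<in> U"
    "\<And>x y v. x \<in> U \<Longrightarrow> y \<in> U \<Longrightarrow> (\<And>u. v \<bullet> L y u = 0) \<Longrightarrow>
       norm (orth_proj (range (L x)) v) \<le> c * dist x y * norm v"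
proof -
  let ?W = "range (L x0)"
  have sub: "subspace (range (L x))" for x
    using lin by (simp add: linear_subspace_image)
  obtain M where M: "linear M" "\<And>u. L x0 (M (L x0 u)) = L x0 u"
    using linear_right_inverse_on_range[OF lin] by blast
  define K where "K x = L x \<circ> M" for x
  have linK: "linear (K x)" for x
    unfolding K_def using M(1) lin by (rule linear_compose)
  have "\<forall>b. \<exists>C d. 0 < d \<and>
      (\<forall>x\<in>ball x0 d. \<forall>y\<in>ball x0 d. norm (L x (M b) - L y (M b)) \<le> C * dist x y)"
    using Lip by blast
  from choice[OF this] obtain C where "\<forall>b. \<exists>d. 0 < d \<and>
      (\<forall>x\<in>ball x0 d. \<forall>y\<in>ball x0 d. norm (L x (M b) - L y (M b)) \<le> C b * dist x y)"
    by blast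
  from choice[OF this] obtain d where Cd: "\<And>b. 0 < d b"
    "\<And>b x y. x \<in> ball x0 (d b) \<Longrightarrow> y \<in> ball x0 (d b) \<Longrightarrow>
       norm (L x (M b) - L y (M b)) \<le> C b * dist x y"
    by blast
  define d0 where "d0 = Min (d ` Basis)"
  define C0 where "C0 = (\<Sum>b\<in>Basis. \<bar>C b\<bar>)"
  have d0: "0 < d0" "\<And>b. b \<in> Basis \<Longrightarrow> d0 \<le> d b"
    unfolding d0_def using Cd(1) by auto
  have C0: "0 \<le> C0" unfolding C0_def by (simp add: sum_nonneg)
  have K_Lip: "norm (K x w - K y w) \<le> C0 * dist x y * norm w"
    if xy: "x \<in> ball x0 d0" "y \<in> ball x0 d0" for x y w
  proof -
    have "K x w - K y w = (\<Sum>b\<in>Basis. (w \<bullet> b) *\<^sub>R (K x b - K y b))"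
    proof -
      have "linear (\<lambda>w. K x w - K y w)"
        using linK by (intro linear_compose_sub)
      from linear_sum[OF this, of "\<lambda>b. (w \<bullet> b) *\<^sub>R b" Basis] show ?thesis
        by (simp add: euclidean_representation linear_scale[OF linK] scaleR_diff_right)
    qed
    also have "norm \<dots> \<le> (\<Sum>b\<in>Basis. norm w * (\<bar>C b\<bar> * dist x y))"
    proof (rule sum_norm_le)
      fix b :: 'a assume b: "b \<in> Basis"
      have "norm (K x b - K y b) \<le> C b * dist x y"
        using Cd(2)[of x b y] xy d0(2)[OF b] by (simp add: K_def)
      also have "\<dots> \<le> \<bar>C b\<bar> * dist x y" by (intro mult_right_mono) auto
      finally show "norm ((w \<bullet> b) *\<^sub>R (K x b - K y b)) \<le> norm w * (\<bar>C b\<bar> * dist x y)"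
        using Basis_le_norm[OF b, of w] by (auto intro!: mult_mono)
    qed
    also have "\<dots> = C0 * dist x y * norm w"
      by (simp add: C0_def sum_distrib_left sum_distrib_right algebra_simps)
    finally show ?thesis .
  qed
  have K0: "K x0 w = w" if "w \<in> ?W" for w
    using that M(2) by (auto simp: K_def)
  \<comment> \<open>Within this radius \<open>K x\<close> differs from the identity of \<open>W\<close> by at most one half in operator norm.\<close>
  define d1 where "d1 = min d0 (1 / (2 * (C0 + 1)))"
  have d1: "0 < d1" using d0 C0 by (simp add: d1_def)
  have K_lower: "norm w \<le> 2 * norm (K x w)" if x: "x \<in> ball x0 d1" and w: "w \<in> ?W" for x w
  proof -
    have "C0 * dist x x0 \<le> (C0 + 1) * (1 / (2 * (C0 + 1)))"
      using x C0 by (intro mult_mono) (auto simp: d1_def dist_commute)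
    also have "\<dots> = 1 / 2" using C0 by (simp add: field_simps)
    finally have "C0 * dist x x0 * norm w \<le> 1 / 2 * norm w"
      by (rule mult_right_mono) simp
    moreover have "norm (K x w - K x0 w) \<le> C0 * dist x x0 * norm w"
      using x d0(1) by (intro K_Lip) (auto simp: d1_def)
    ultimately have "norm (K x w - w) \<le> 1 / 2 * norm w" using K0[OF w] by simp
    moreover have "norm w \<le> norm (K x w) + norm (K x w - w)"
      by (metis norm_minus_commute norm_triangle_sub)
    ultimately show ?thesis by simp
  qed
  obtain U1 where U1: "open U1" "x0 \<in> U1"
    "\<And>x. x \<in> U1 \<Longrightarrow> dim (range (L x)) \<le> dim ?W"
    using rank unfolding eventually_nhds by blast
  have K_onto: "K x ` ?W = range (L x)" if x: "x \<in> ball x0 d1" "x \<in> U1" for x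
  proof (rule subspace_dim_equal)
    show "subspace (K x ` ?W)" by (rule linear_subspace_image[OF linK sub])
    show "subspace (range (L x))" by (rule sub)
    show "K x ` ?W \<subseteq> range (L x)" by (auto simp: K_def)
    have "inj_on (K x) ?W"
    proof (rule inj_onI)
      fix a b assume ab: "a \<in> ?W" "b \<in> ?W" "K x a = K x b"
      then have "norm (a - b) \<le> 2 * norm (K x (a - b))"
        using x sub by (intro K_lower) (auto intro: subspace_diff)
      then show "a = b" using ab(3) by (simp add: linear_diff[OF linK])
    qed
    then have "dim (K x ` ?W) = dim ?W"
      using linK sub by (intro dim_image_eq) (auto simp: span_eq_iff[THEN iffD2])
    then show "dim (range (L x)) \<le> dim (K x ` ?W)" using U1(3)[OF x(2)] by simp
  qed
  show ?thesis
  proof (rule that[of "2 * C0 + 1" "ball x0 d1 \<inter> U1"])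
    show "0 < 2 * C0 + 1" using C0 by simp
    show "open (ball x0 d1 \<inter> U1)" "x0 \<in> ball x0 d1 \<inter> U1" using U1 d1 by auto
    fix x y v
    assume x: "x \<in> ball x0 d1 \<inter> U1" and y: "y \<in> ball x0 d1 \<inter> U1"
      and orth: "\<And>u. v \<bullet> L y u = 0"
    define p where "p = orth_proj (range (L x)) v"
    have p: "p \<in> range (L x)" "orthogonal (v - p) p"
      using orth_proj_subspace[OF sub, of x v] by (auto simp: p_def)
    then obtain w where w: "w \<in> ?W" "p = K x w"
      using K_onto[of x] x by (metis IntD1 IntD2 image_iff)
    have "norm p * norm p = v \<bullet> p"
      using p(2) by (simp add: orthogonal_def inner_diff_left power2_eq_square flip: power2_norm_eq_inner)
    also have "v \<bullet> p = v \<bullet> (K x w - K y w)"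
      using orth by (simp add: w(2) inner_diff_right K_def)
    also have "\<dots> \<le> norm v * norm (K x w - K y w)" by (rule norm_cauchy_schwarz)
    also have "\<dots> \<le> norm v * (C0 * dist x y * norm w)"
      using x y by (intro mult_left_mono K_Lip) (auto simp: d1_def)
    also have "\<dots> \<le> norm v * (C0 * dist x y * (2 * norm p))"
      using K_lower[of x w] x w C0 by (intro mult_left_mono) auto
    also have "\<dots> = (2 * C0 * dist x y * norm v) * norm p" by simp
    finally have "norm p \<le> 2 * C0 * dist x y * norm v"
      using C0 by (cases "p = 0") (auto simp: mult_le_cancel_right)
    also have "\<dots> \<le> (2 * C0 + 1) * dist x y * norm v"
      by (intro mult_right_mono) auto
    finally show "norm (orth_proj (range (L x)) v) \<le> (2 * C0 + 1) * dist x y * norm v"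
      by (simp add: p_def)
  qed
qed

section \<open>The action in charts\<close>

lemma Cn_on_cong_open:
  assumes "open S" "\<And>x. x \<in> S \<Longrightarrow> f x = g x" "Cn_on n f S"
  shows "Cn_on n g S"
  using assms(2,3)
proof (induction n arbitrary: f g)
  case 0
  then have "continuous_on S f" by simp
  then have "continuous_on S g"
    by (rule continuous_on_eq) (rule 0)
  then show ?case by simp
next
  case (Suc n)
  have der: "(g has_derivative frechet_derivative f (at x)) (at x)" if x: "x \<in> S" for x
  proof -
    have "(f has_derivative frechet_derivative f (at x)) (at x)"
      using Suc.prems(2) x by (simp add: frechet_derivative_works)
    then show ?thesis
      using has_derivative_transform_within_open[OF _ assms(1) x] Suc.prems(1) by blast
  qed
  have "Cn_on n (\<lambda>x. frechet_derivative g (at x) v) S" for v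
  proof (rule Suc.IH)
    show "Cn_on n (\<lambda>x. frechet_derivative f (at x) v) S"
      using Suc.prems(2) by simp
    show "frechet_derivative f (at x) v = frechet_derivative g (at x) v" if "x \<in> S" for x
      using frechet_derivative_at[OF der[OF that]] by simp
  qed
  then show ?case
    using der by (auto simp: differentiable_def)
qed

lemma inv_into_map_prod:
  assumes "inj_on \<phi> U" "inj_on \<psi> V" "p \<in> \<phi> ` U" "q \<in> \<psi> ` V"
  shows "inv_into (U \<times> V) (map_prod \<phi> \<psi>) (p, q) = (inv_into U \<phi> p, inv_into V \<psi> q)"
proof (rule inv_into_f_eq)
  show "inj_on (map_prod \<phi> \<psi>) (U \<times> V)"
    using assms(1,2) by (rule map_prod_inj_on)
  show "(inv_into U \<phi> p, inv_into V \<psi> q) \<in> U \<times> V"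
    using assms(3,4) by (simp add: inv_into_into)
  show "map_prod \<phi> \<psi> (inv_into U \<phi> p, inv_into V \<psi> q) = (p, q)"
    using assms(3,4) by (simp add: f_inv_into_f)
qed

context lie_group_action
begin

lemma chart_props:
  assumes "(U, \<phi>) \<in> A"
  shows "openin T U" "U \<subseteq> carrier G" "open (\<phi> ` U)" "inj_on \<phi> U"
proof -
  have c: "openin T U" "open (\<phi> ` U)"
    "homeomorphic_map (subtopology T U) (top_of_set (\<phi> ` U)) \<phi>"
    using charts[OF assms] by (auto simp: is_chart_def)
  show "openin T U" "open (\<phi> ` U)" by fact+
  show "U \<subseteq> carrier G"
    using openin_subset[OF c(1)] topspace by simp
  then show "inj_on \<phi> U"
    using homeomorphic_imp_injective_map[OF c(3)] topspace by (simp add: Int_absorb1)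
qed

text \<open>
  Transports neighborhoods in the group to neighborhoods in a chart, on which derivatives of
  functions that agree there can be compared.
\<close>

lemma open_chart_image:
  assumes "(U, \<phi>) \<in> A" "openin T N" "N \<subseteq> U"
  shows "open (\<phi> ` N)"
proof -
  have "homeomorphic_map (subtopology T U) (top_of_set (\<phi> ` U)) \<phi>"
    using charts[OF assms(1)] by (auto simp: is_chart_def)
  then have "open_map (subtopology T U) (top_of_set (\<phi> ` U)) \<phi>"
    by (rule homeomorphic_imp_open_map)
  moreover have "openin (subtopology T U) N"
    using assms(2,3) by (auto simp: openin_subtopology)
  ultimately have "openin (top_of_set (\<phi> ` U)) (\<phi> ` N)"
    by (simp add: open_map_def)
  then show ?thesis
    using chart_props(3)[OF assms(1)] by (rule openin_open_trans)
qed

lemma chart_exists: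
  assumes "g \<in> carrier G"
  obtains U \<phi> where "(U, \<phi>) \<in> A" "g \<in> U"
proof -
  have "g \<in> (\<Union>c\<in>A. fst c)" using assms cover topspace by simp
  then obtain c where "c \<in> A" "g \<in> fst c" by blast
  then show ?thesis using that[of "fst c" "snd c"] by simp
qed

lemma inv_into_chart:
  assumes "(U, \<phi>) \<in> A" "g \<in> U"
  shows "inv_into U \<phi> (\<phi> g) = g"
  using chart_props(4)[OF assms(1)] assms(2) by simp

lemma mult_differentiable_in_charts:
  assumes k: "1 \<le> k"
    and W: "(W, \<omega>) \<in> A" "a \<in> W" and U: "(U, \<phi>) \<in> A" "g \<in> U" and V: "(V, \<psi>) \<in> A" "a \<otimes> g \<in> V"
  shows "(\<lambda>(p, q). \<psi> (inv_into W \<omega> p \<otimes> inv_into U \<phi> q)) differentiable (at (\<omega> a, \<phi> g))"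
proof -
  define m where "m = (\<lambda>(g, h). g \<otimes> h)"
  let ?\<Phi> = "\<psi> \<circ> m \<circ> inv_into (W \<times> U) (map_prod \<omega> \<phi>)"
  define S where "S = map_prod \<omega> \<phi> ` {p \<in> W \<times> U. m p \<in> V}"
  have "(W \<times> U, map_prod \<omega> \<phi>) \<in> prod_atlas A A"
    using W(1) U(1) by (auto simp: prod_atlas_def)
  then have "Ck_on k ?\<Phi> S"
    using mult_Ck V(1) unfolding Ck_map_def S_def m_def by blast
  then have "Cn_on (Suc 0) ?\<Phi> S"
    using k unfolding Ck_on_def one_enat_def One_nat_def by blast
  moreover have "(\<omega> a, \<phi> g) \<in> S"
    using W(2) U(2) V(2) by (auto simp: S_def m_def intro!: image_eqI[of _ _ "(a, g)"])
  ultimately have "?\<Phi> differentiable (at (\<omega> a, \<phi> g))"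
    unfolding Cn_on.simps(2) by blast
  then obtain D where "(?\<Phi> has_derivative D) (at (\<omega> a, \<phi> g))"
    unfolding differentiable_def by blast
  then have "((\<lambda>(p, q). \<psi> (inv_into W \<omega> p \<otimes> inv_into U \<phi> q)) has_derivative D) (at (\<omega> a, \<phi> g))"
  proof (rule has_derivative_transform_within_open[where s = "\<omega> ` W \<times> \<phi> ` U"])
    show "open (\<omega> ` W \<times> \<phi> ` U)"
      using chart_props(3) W(1) U(1) by (intro open_Times)
    show "(\<omega> a, \<phi> g) \<in> \<omega> ` W \<times> \<phi> ` U" using W(2) U(2) by simp
    fix z assume "z \<in> \<omega> ` W \<times> \<phi> ` U"
    then obtain p q where z: "z = (p, q)" "p \<in> \<omega> ` W" "q \<in> \<phi> ` U" by blast
    show "?\<Phi> z = (case z of (p, q) \<Rightarrow> \<psi> (inv_into W \<omega> p \<otimes> inv_into U \<phi> q))"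
      using inv_into_map_prod[OF chart_props(4)[OF W(1)] chart_props(4)[OF U(1)] z(2,3)]
      by (simp add: z(1) m_def)
  qed
  then show ?thesis by (rule differentiableI)
qed

lemma left_mult_in_charts:
  assumes k: "1 \<le> k" and a: "a \<in> carrier G"
    and U: "(U, \<phi>) \<in> A" "g \<in> U" and V: "(V, \<psi>) \<in> A" "a \<otimes> g \<in> V"
  shows "(\<lambda>q. \<psi> (a \<otimes> inv_into U \<phi> q)) differentiable (at (\<phi> g))"
    and "open (\<phi> ` {h \<in> U. a \<otimes> h \<in> V})"
proof -
  obtain W \<omega> where W: "(W, \<omega>) \<in> A" "a \<in> W" using chart_exists[OF a] .
  have "((\<lambda>(p, q). \<psi> (inv_into W \<omega> p \<otimes> inv_into U \<phi> q)) \<circ> (\<lambda>q. (\<omega> a, q)))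
      differentiable (at (\<phi> g))"
    using mult_differentiable_in_charts[OF k W U V]
    by (intro differentiable_chain_at differentiable_Pair) auto
  then show "(\<lambda>q. \<psi> (a \<otimes> inv_into U \<phi> q)) differentiable (at (\<phi> g))"
    by (simp add: o_def inv_into_chart[OF W])
  have "continuous_map T T ((\<lambda>(g, h). g \<otimes> h) \<circ> (\<lambda>h. (a, h)))"
  proof (rule continuous_map_compose)
    show "continuous_map T (prod_topology T T) (\<lambda>h. (a, h))"
      using a topspace by (intro continuous_map_pairedI) simp_all
    show "continuous_map (prod_topology T T) T (\<lambda>(g, h). g \<otimes> h)"
      using mult_Ck unfolding Ck_map_def by (rule conjunct1)
  qed
  then have "continuous_map T T (\<lambda>h. a \<otimes> h)" by (simp add: o_def)
  then have "openin T {h \<in> topspace T. a \<otimes> h \<in> V}"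
    using chart_props(1)[OF V(1)] by (rule openin_continuous_map_preimage)
  then have "openin T (U \<inter> {h \<in> topspace T. a \<otimes> h \<in> V})"
    using chart_props(1)[OF U(1)] by (intro openin_Int)
  moreover have "U \<inter> {h \<in> topspace T. a \<otimes> h \<in> V} = {h \<in> U. a \<otimes> h \<in> V}"
    using chart_props(2)[OF U(1)] topspace by auto
  ultimately show "open (\<phi> ` {h \<in> U. a \<otimes> h \<in> V})"
    using open_chart_image[OF U(1)] by auto
qed

lemma right_mult_in_charts:
  assumes k: "1 \<le> k" and a: "a \<in> carrier G"
    and U: "(U, \<phi>) \<in> A" "g \<in> U" and V: "(V, \<psi>) \<in> A" "g \<otimes> a \<in> V"
  shows "(\<lambda>q. \<psi> (inv_into U \<phi> q \<otimes> a)) differentiable (at (\<phi> g))"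
    and "open (\<phi> ` {h \<in> U. h \<otimes> a \<in> V})"
proof -
  obtain W \<omega> where W: "(W, \<omega>) \<in> A" "a \<in> W" using chart_exists[OF a] .
  have "((\<lambda>(p, q). \<psi> (inv_into U \<phi> p \<otimes> inv_into W \<omega> q)) \<circ> (\<lambda>p. (p, \<omega> a)))
      differentiable (at (\<phi> g))"
    using mult_differentiable_in_charts[OF k U W V]
    by (intro differentiable_chain_at differentiable_Pair) auto
  then show "(\<lambda>q. \<psi> (inv_into U \<phi> q \<otimes> a)) differentiable (at (\<phi> g))"
    by (simp add: o_def inv_into_chart[OF W])
  have "continuous_map T T ((\<lambda>(g, h). g \<otimes> h) \<circ> (\<lambda>h. (h, a)))"
  proof (rule continuous_map_compose)
    show "continuous_map T (prod_topology T T) (\<lambda>h. (h, a))"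
      using a topspace by (intro continuous_map_pairedI) simp_all
    show "continuous_map (prod_topology T T) T (\<lambda>(g, h). g \<otimes> h)"
      using mult_Ck unfolding Ck_map_def by (rule conjunct1)
  qed
  then have "continuous_map T T (\<lambda>h. h \<otimes> a)" by (simp add: o_def)
  then have "openin T {h \<in> topspace T. h \<otimes> a \<in> V}"
    using chart_props(1)[OF V(1)] by (rule openin_continuous_map_preimage)
  then have "openin T (U \<inter> {h \<in> topspace T. h \<otimes> a \<in> V})"
    using chart_props(1)[OF U(1)] by (intro openin_Int)
  moreover have "U \<inter> {h \<in> topspace T. h \<otimes> a \<in> V} = {h \<in> U. h \<otimes> a \<in> V}"
    using chart_props(2)[OF U(1)] topspace by auto
  ultimately show "open (\<phi> ` {h \<in> U. h \<otimes> a \<in> V})"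
    using open_chart_image[OF U(1)] by auto
qed

definition chart_action :: "'g set \<Rightarrow> ('g \<Rightarrow> 'e) \<Rightarrow> 'e \<times> 'a \<Rightarrow> 'a" where
  "chart_action U \<phi> = (\<lambda>(p, x). \<theta> (inv_into U \<phi> p) x)"

text \<open>
  The partial derivative, in the group variable, of the action read in the chart \<open>(U, \<phi>)\<close>; at
  \<open>p = \<phi> \<one>\<close> it is the differential at the identity of the orbit map of \<open>x\<close>, whose range is the
  tangent space of the orbit. Defining it through the joint derivative exhibits its dependence on \<open>x\<close>.
\<close>

definition orbit_deriv :: "'g set \<Rightarrow> ('g \<Rightarrow> 'e) \<Rightarrow> 'e \<Rightarrow> 'a \<Rightarrow> 'e \<Rightarrow> 'a" where
  "orbit_deriv U \<phi> p x v = frechet_derivative (chart_action U \<phi>) (at (p, x)) (v, 0)"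

lemma Cn_on_chart_action:
  assumes U: "(U, \<phi>) \<in> A" and n: "enat n \<le> k"
  shows "Cn_on n (chart_action U \<phi>) (\<phi> ` U \<times> UNIV)"
proof (rule Cn_on_cong_open)
  let ?F = "id \<circ> (\<lambda>(g, x). \<theta> g x) \<circ> inv_into (U \<times> UNIV) (map_prod \<phi> id)"
  show "open (\<phi> ` U \<times> (UNIV :: 'a set))"
    using chart_props(3)[OF U] by (intro open_Times) auto
  have "(U \<times> UNIV, map_prod \<phi> id) \<in> prod_atlas A (std_atlas :: ('a, 'a) atlas)"
    using U by (auto simp: prod_atlas_def std_atlas_def)
  moreover have "(UNIV, id) \<in> (std_atlas :: ('a, 'a) atlas)" by (simp add: std_atlas_def)
  ultimately have "Ck_on k ?F
      (map_prod \<phi> id ` {p \<in> U \<times> UNIV. (case p of (g, x) \<Rightarrow> \<theta> g x) \<in> UNIV})"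
    using action_Ck unfolding Ck_map_def by blast
  moreover have "map_prod \<phi> id ` {p \<in> U \<times> UNIV. (case p of (g, x) \<Rightarrow> \<theta> g x) \<in> UNIV}
      = \<phi> ` U \<times> (UNIV :: 'a set)"
    by force
  ultimately show "Cn_on n ?F (\<phi> ` U \<times> UNIV)"
    using n by (simp add: Ck_on_def)
  fix z assume "z \<in> \<phi> ` U \<times> (UNIV :: 'a set)"
  then obtain p x where z: "z = (p, x)" "p \<in> \<phi> ` U" by auto
  have "inv_into (U \<times> UNIV) (map_prod \<phi> id) (p, x) = (inv_into U \<phi> p, x)"
    using inv_into_map_prod[OF chart_props(4)[OF U] inj_on_id z(2), of x UNIV] by simp
  then show "?F z = chart_action U \<phi> z"
    by (simp add: z(1) chart_action_def)
qed

lemma chart_action_has_derivative: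
  assumes U: "(U, \<phi>) \<in> A" and k: "1 \<le> k" and p: "p \<in> \<phi> ` U"
  shows "(chart_action U \<phi> has_derivative frechet_derivative (chart_action U \<phi>) (at (p, x))) (at (p, x))"
proof -
  have "Cn_on (Suc 0) (chart_action U \<phi>) (\<phi> ` U \<times> UNIV)"
    using k by (intro Cn_on_chart_action U) (simp add: one_enat_def)
  then have "chart_action U \<phi> differentiable (at (p, x))"
    using p unfolding Cn_on.simps(2) by blast
  then show ?thesis
    by (simp add: frechet_derivative_works)
qed

lemma orbit_has_derivative:
  assumes U: "(U, \<phi>) \<in> A" and k: "1 \<le> k" and p: "p \<in> \<phi> ` U"
  shows "((\<lambda>p. \<theta> (inv_into U \<phi> p) x) has_derivative orbit_deriv U \<phi> p x) (at p)"
proof -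
  have "((\<lambda>p. (p, x)) has_derivative (\<lambda>v. (v, 0))) (at p)"
    by (auto intro!: derivative_eq_intros)
  from diff_chain_at[OF this chart_action_has_derivative[OF U k p]]
  show ?thesis
    by (simp add: o_def chart_action_def orbit_deriv_def[abs_def])
qed

lemma linear_orbit_deriv:
  assumes "(U, \<phi>) \<in> A" "1 \<le> k" "p \<in> \<phi> ` U"
  shows "linear (orbit_deriv U \<phi> p x)"
  using orbit_has_derivative[OF assms] by (rule has_derivative_linear)

lemma action_has_derivative:
  assumes g: "g \<in> carrier G" and k: "1 \<le> k"
  obtains D where "(\<theta> g has_derivative D) (at x)"
proof -
  obtain U \<phi> where U: "(U, \<phi>) \<in> A" "g \<in> U" using chart_exists[OF g] .
  have "((\<lambda>x. (\<phi> g, x)) has_derivative (\<lambda>v. (0, v))) (at x)"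
    by (auto intro!: derivative_eq_intros)
  from diff_chain_at[OF this chart_action_has_derivative[OF U(1) k imageI[OF U(2)]]]
  have "(\<theta> g has_derivative (\<lambda>v. frechet_derivative (chart_action U \<phi>) (at (\<phi> g, x)) (0, v))) (at x)"
    by (simp add: o_def chart_action_def inv_into_chart[OF U])
  then show ?thesis by (rule that)
qed

lemma continuous_on_orbit_deriv:
  assumes U: "(U, \<phi>) \<in> A" and k: "1 \<le> k"
  shows "continuous_on (\<phi> ` U) (\<lambda>p. orbit_deriv U \<phi> p x v)"
proof -
  have "Cn_on (Suc 0) (chart_action U \<phi>) (\<phi> ` U \<times> UNIV)"
    using k by (intro Cn_on_chart_action U) (simp add: one_enat_def)
  then have "continuous_on (\<phi> ` U \<times> UNIV)
      (\<lambda>z. frechet_derivative (chart_action U \<phi>) (at z) (v, 0))"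
    by simp
  then have "continuous_on (\<phi> ` U)
      (\<lambda>p. frechet_derivative (chart_action U \<phi>) (at (p, x)) (v, 0))"
    by (rule continuous_on_compose2[where f = "\<lambda>p. (p, x)"]) (auto intro!: continuous_intros)
  then show ?thesis by (simp add: orbit_deriv_def)
qed

text \<open>
  One order of differentiability is spent on the group variable; the second one makes the tangent
  space at \<open>x\<close> depend on \<open>x\<close> in a continuously differentiable way.
\<close>

lemma orbit_deriv_C1_in_point:
  assumes U: "(U, \<phi>) \<in> A" and k: "2 \<le> k" and p: "p \<in> \<phi> ` U"
  obtains D where "\<And>x. ((\<lambda>x. orbit_deriv U \<phi> p x v) has_derivative D x) (at x)"
    "\<And>w. continuous_on UNIV (\<lambda>x. D x w)"
proof -
  let ?q = "\<lambda>z. frechet_derivative (chart_action U \<phi>) (at z) (v, 0)"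
  have "Cn_on (Suc (Suc 0)) (chart_action U \<phi>) (\<phi> ` U \<times> UNIV)"
    using k by (intro Cn_on_chart_action U) (simp add: numeral_eq_enat numeral_2_eq_2)
  then have q: "Cn_on (Suc 0) ?q (\<phi> ` U \<times> UNIV)"
    unfolding Cn_on.simps(2)[of "Suc 0"] by blast
  show ?thesis
  proof (rule that[of "\<lambda>x w. frechet_derivative ?q (at (p, x)) (0, w)"])
    fix x
    have dq: "(?q has_derivative frechet_derivative ?q (at (p, x))) (at (p, x))"
      using q p unfolding Cn_on.simps(2) by (simp only: frechet_derivative_works) blast
    have "((\<lambda>x. (p, x)) has_derivative (\<lambda>w. (0, w))) (at x)"
      by (auto intro!: derivative_eq_intros)
    from diff_chain_at[OF this dq]
    show "((\<lambda>x. orbit_deriv U \<phi> p x v) has_derivative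
        (\<lambda>w. frechet_derivative ?q (at (p, x)) (0, w))) (at x)"
      by (simp add: o_def orbit_deriv_def)
  next
    fix w
    have "continuous_on (\<phi> ` U \<times> UNIV) (\<lambda>z. frechet_derivative ?q (at z) (0, w))"
      using q by simp
    then show "continuous_on UNIV (\<lambda>x. frechet_derivative ?q (at (p, x)) (0, w))"
      by (rule continuous_on_compose2[where f = "\<lambda>x. (p, x)"]) (use p in \<open>auto intro!: continuous_intros\<close>)
  qed
qed

section \<open>The rank of the orbit maps\<close>

lemma action_one: "\<theta> \<one> x = x"
  using fun_cong[OF id_eq_one, of x] by simp

lemma action_mult: "g \<in> carrier G \<Longrightarrow> h \<in> carrier G \<Longrightarrow> \<theta> (g \<otimes> h) x = \<theta> g (\<theta> h x)"
  by (simp add: composition_rule)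

text \<open>
  Equivariance, \<open>\<theta> h x = \<theta> g (\<theta> (inv g \<otimes> h) x)\<close>, expresses the orbit map near \<open>g\<close> through the orbit
  map near the identity. By the chain rule its derivative at \<open>g\<close> takes its values in the image, under
  the derivative of \<open>\<theta> g\<close>, of the tangent space at the identity.
\<close>

lemma rank_orbit_deriv_le:
  assumes U: "(U, \<phi>) \<in> A" "\<one> \<in> U" and V: "(V, \<psi>) \<in> A" "g \<in> V" and k: "1 \<le> k"
  shows "dim (range (orbit_deriv V \<psi> (\<psi> g) x)) \<le> dim (range (orbit_deriv U \<phi> (\<phi> \<one>) x))"
proof -
  have g: "g \<in> carrier G" using V chart_props(2) by blast
  then have ig: "inv g \<in> carrier G" by simp
  have igg: "inv g \<otimes> g \<in> U" using U(2) g by simp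
  define \<mu> where "\<mu> q = \<phi> (inv g \<otimes> inv_into V \<psi> q)" for q
  define N where "N = \<psi> ` {h \<in> V. inv g \<otimes> h \<in> U}"
  obtain \<mu>' where \<mu>': "(\<mu> has_derivative \<mu>') (at (\<psi> g))"
    using left_mult_in_charts(1)[OF k ig V U(1) igg]
    by (auto simp: differentiable_def \<mu>_def[abs_def])
  have N: "open N" "\<psi> g \<in> N"
    using left_mult_in_charts(2)[OF k ig V U(1) igg] V(2) igg by (auto simp: N_def)
  obtain D where D: "(\<theta> g has_derivative D) (at x)"
    using action_has_derivative[OF g k] .
  have \<mu>g: "\<mu> (\<psi> g) = \<phi> \<one>" using g by (simp add: \<mu>_def inv_into_chart[OF V])
  let ?F = "\<lambda>p. \<theta> (inv_into U \<phi> p) x"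
  have "(?F has_derivative orbit_deriv U \<phi> (\<phi> \<one>) x) (at (\<mu> (\<psi> g)))"
    using orbit_has_derivative[OF U(1) k imageI[OF U(2)]] by (simp add: \<mu>g)
  from diff_chain_at[OF \<mu>' this]
  have "(?F \<circ> \<mu> has_derivative orbit_deriv U \<phi> (\<phi> \<one>) x \<circ> \<mu>') (at (\<psi> g))" .
  moreover have "(\<theta> g has_derivative D) (at ((?F \<circ> \<mu>) (\<psi> g)))"
    using D by (simp add: \<mu>g inv_into_chart[OF U] action_one)
  ultimately have "(\<theta> g \<circ> (?F \<circ> \<mu>) has_derivative D \<circ> (orbit_deriv U \<phi> (\<phi> \<one>) x \<circ> \<mu>')) (at (\<psi> g))"
    by (rule diff_chain_at)
  then have "((\<lambda>q. \<theta> (inv_into V \<psi> q) x) has_derivative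
      D \<circ> (orbit_deriv U \<phi> (\<phi> \<one>) x \<circ> \<mu>')) (at (\<psi> g))"
  proof (rule has_derivative_transform_within_open[OF _ N])
    fix q assume "q \<in> N"
    then obtain h where h: "q = \<psi> h" "h \<in> V" "inv g \<otimes> h \<in> U" by (auto simp: N_def)
    have hc: "h \<in> carrier G" using h(2) V(1) chart_props(2) by blast
    have "g \<otimes> (inv g \<otimes> h) = h" using g hc by (simp flip: m_assoc)
    then have "\<theta> h x = \<theta> g (\<theta> (inv g \<otimes> h) x)"
      using g hc by (metis action_mult ig m_closed)
    then show "(\<theta> g \<circ> (?F \<circ> \<mu>)) q = \<theta> (inv_into V \<psi> q) x"
      by (simp add: \<mu>_def h(1) inv_into_chart[OF V(1) h(2)] inv_into_chart[OF U(1) h(3)])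
  qed
  then have "orbit_deriv V \<psi> (\<psi> g) x = D \<circ> (orbit_deriv U \<phi> (\<phi> \<one>) x \<circ> \<mu>')"
    by (rule has_derivative_unique[OF orbit_has_derivative[OF V(1) k imageI[OF V(2)]]])
  then have "range (orbit_deriv V \<psi> (\<psi> g) x) \<subseteq> D ` range (orbit_deriv U \<phi> (\<phi> \<one>) x)"
    by auto
  then have "dim (range (orbit_deriv V \<psi> (\<psi> g) x)) \<le> dim (D ` range (orbit_deriv U \<phi> (\<phi> \<one>) x))"
    by (rule dim_subset)
  also have "\<dots> \<le> dim (range (orbit_deriv U \<phi> (\<phi> \<one>) x))"
    using D has_derivative_linear by (intro dim_image_le) blast
  finally show ?thesis .
qed

text \<open>
  The orbit map of \<open>\<theta> g x\<close> is the orbit map of \<open>x\<close> after right translation by \<open>g\<close>, so its derivative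
  at the identity factors through the derivative of the orbit map of \<open>x\<close> at \<open>g\<close>.
\<close>

lemma rank_orbit_deriv_translate_le:
  assumes U: "(U, \<phi>) \<in> A" "\<one> \<in> U" and g: "g \<in> carrier G" and k: "1 \<le> k"
  shows "dim (range (orbit_deriv U \<phi> (\<phi> \<one>) (\<theta> g x))) \<le> dim (range (orbit_deriv U \<phi> (\<phi> \<one>) x))"
proof -
  obtain V \<psi> where V: "(V, \<psi>) \<in> A" "g \<in> V" using chart_exists[OF g] .
  have 1: "\<one> \<otimes> g \<in> V" using V(2) g by simp
  define \<mu> where "\<mu> q = \<psi> (inv_into U \<phi> q \<otimes> g)" for q
  define N where "N = \<phi> ` {h \<in> U. h \<otimes> g \<in> V}"
  obtain \<mu>' where \<mu>': "(\<mu> has_derivative \<mu>') (at (\<phi> \<one>))"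
    using right_mult_in_charts(1)[OF k g U V(1) 1]
    by (auto simp: differentiable_def \<mu>_def[abs_def])
  have N: "open N" "\<phi> \<one> \<in> N"
    using right_mult_in_charts(2)[OF k g U V(1) 1] U(2) 1 by (auto simp: N_def)
  have \<mu>1: "\<mu> (\<phi> \<one>) = \<psi> g" using g by (simp add: \<mu>_def inv_into_chart[OF U])
  let ?F = "\<lambda>q. \<theta> (inv_into V \<psi> q) x"
  have "(?F has_derivative orbit_deriv V \<psi> (\<psi> g) x) (at (\<mu> (\<phi> \<one>)))"
    using orbit_has_derivative[OF V(1) k imageI[OF V(2)]] by (simp add: \<mu>1)
  from diff_chain_at[OF \<mu>' this]
  have "((\<lambda>p. \<theta> (inv_into U \<phi> p) (\<theta> g x)) has_derivative
      orbit_deriv V \<psi> (\<psi> g) x \<circ> \<mu>') (at (\<phi> \<one>))"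
  proof (rule has_derivative_transform_within_open[OF _ N])
    fix p assume "p \<in> N"
    then obtain h where h: "p = \<phi> h" "h \<in> U" "h \<otimes> g \<in> V" by (auto simp: N_def)
    have hc: "h \<in> carrier G" using h(2) U(1) chart_props(2) by blast
    show "(?F \<circ> \<mu>) p = \<theta> (inv_into U \<phi> p) (\<theta> g x)"
      using action_mult[OF hc g]
      by (simp add: \<mu>_def h(1) inv_into_chart[OF U(1) h(2)] inv_into_chart[OF V(1) h(3)])
  qed
  then have "orbit_deriv U \<phi> (\<phi> \<one>) (\<theta> g x) = orbit_deriv V \<psi> (\<psi> g) x \<circ> \<mu>'"
    by (rule has_derivative_unique[OF orbit_has_derivative[OF U(1) k imageI[OF U(2)]]])
  then have "range (orbit_deriv U \<phi> (\<phi> \<one>) (\<theta> g x)) \<subseteq> range (orbit_deriv V \<psi> (\<psi> g) x)"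
    by auto
  then have "dim (range (orbit_deriv U \<phi> (\<phi> \<one>) (\<theta> g x))) \<le> dim (range (orbit_deriv V \<psi> (\<psi> g) x))"
    by (rule dim_subset)
  also have "\<dots> \<le> dim (range (orbit_deriv U \<phi> (\<phi> \<one>) x))"
    by (rule rank_orbit_deriv_le[OF U V k])
  finally show ?thesis .
qed

text \<open>
  The isotropy group determines the kernel of the differential of the orbit map. Orbit maps have
  constant rank by \<open>rank_orbit_deriv_le\<close>, so a kernel vector for \<open>x\<close> is the velocity of a curve in the
  isotropy group of \<open>x\<close>. That curve also fixes \<open>z\<close>, hence its velocity lies in the kernel for \<open>z\<close>.
\<close>

lemma orbit_deriv_kernel_mono:
  assumes U: "(U, \<phi>) \<in> A" "\<one> \<in> U" and k: "1 \<le> k"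
    and stab: "stabilizer G \<theta> x \<subseteq> stabilizer G \<theta> z"
    and E: "orbit_deriv U \<phi> (\<phi> \<one>) x E = 0"
  shows "orbit_deriv U \<phi> (\<phi> \<one>) z E = 0"
proof -
  have p0: "\<phi> \<one> \<in> \<phi> ` U" using U(2) by simp
  have rank: "dim (range (orbit_deriv U \<phi> p x)) \<le> dim (range (orbit_deriv U \<phi> (\<phi> \<one>) x))"
    if "p \<in> \<phi> ` U" for p
    using rank_orbit_deriv_le[OF U U(1) _ k] that by auto
  obtain c where c: "c 0 = \<phi> \<one>" "(c has_vector_derivative E) (at 0)"
    and fib: "\<forall>\<^sub>F t in nhds (0::real). c t \<in> \<phi> ` U \<and>
        \<theta> (inv_into U \<phi> (c t)) x = \<theta> (inv_into U \<phi> (\<phi> \<one>)) x"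
    by (rule constant_rank_fibre_curve[OF chart_props(3)[OF U(1)] p0
          orbit_has_derivative[OF U(1) k] continuous_on_orbit_deriv[OF U(1) k] rank E])
  have "((\<lambda>t. \<theta> (inv_into U \<phi> (c t)) z) has_derivative
      (\<lambda>t. orbit_deriv U \<phi> (\<phi> \<one>) z (t *\<^sub>R E))) (at 0)"
    using diff_chain_at[OF c(2)[unfolded has_vector_derivative_def], unfolded c(1),
        OF orbit_has_derivative[OF U(1) k p0]] by (simp add: o_def)
  moreover have "((\<lambda>t. \<theta> (inv_into U \<phi> (c t)) z) has_derivative (\<lambda>t. 0)) (at 0)"
  proof -
    have "\<forall>\<^sub>F t in nhds 0. z = \<theta> (inv_into U \<phi> (c t)) z"
      using fib
    proof eventually_elim
      case (elim t)
      then have "inv_into U \<phi> (c t) \<in> carrier G"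
        using chart_props(2)[OF U(1)] by (meson inv_into_into subsetD)
      moreover have "\<theta> (inv_into U \<phi> (c t)) x = x"
        using elim by (simp add: inv_into_chart[OF U] action_one)
      ultimately show ?case
        using stab by (auto simp: stabilizer_def)
    qed
    then obtain S where S: "open S" "0 \<in> S" "\<And>t. t \<in> S \<Longrightarrow> z = \<theta> (inv_into U \<phi> (c t)) z"
      unfolding eventually_nhds by blast
    show ?thesis
      by (rule has_derivative_transform_within_open[OF has_derivative_const[of z] S])
  qed
  ultimately have "(\<lambda>t. orbit_deriv U \<phi> (\<phi> \<one>) z (t *\<^sub>R E)) = (\<lambda>t. 0)"
    by (rule has_derivative_unique)
  from fun_cong[OF this, of 1] show ?thesis by simp
qed

text \<open>
  Equal types mean that \<open>x\<close> has the same isotropy group as some point \<open>\<theta> g y\<close> of the orbit of \<open>y\<close>;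
  kernels, and thus ranks, are compared there, and translation leads back to \<open>y\<close>.
\<close>

lemma rank_le_if_orbit_type_eq:
  assumes U: "(U, \<phi>) \<in> A" "\<one> \<in> U" and k: "1 \<le> k"
    and type: "orbit_type G \<theta> x = orbit_type G \<theta> y"
  shows "dim (range (orbit_deriv U \<phi> (\<phi> \<one>) x)) \<le> dim (range (orbit_deriv U \<phi> (\<phi> \<one>) y))"
proof -
  have p0: "\<phi> \<one> \<in> \<phi> ` U" using U(2) by simp
  have sub: "stabilizer G \<theta> x \<subseteq> carrier G" by (auto simp: stabilizer_def)
  have "(\<one> <# stabilizer G \<theta> x) #> inv \<one> \<in> orbit_type G \<theta> x"
    unfolding orbit_type_def by blast
  moreover have "(\<one> <# stabilizer G \<theta> x) #> inv \<one> = stabilizer G \<theta> x"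
    using sub by (simp add: lcos_mult_one coset_mult_one)
  ultimately have "stabilizer G \<theta> x \<in> orbit_type G \<theta> y" using type by simp
  then obtain g where g: "g \<in> carrier G"
    and stab: "stabilizer G \<theta> x = (g <# stabilizer G \<theta> y) #> inv g"
    unfolding orbit_type_def by blast
  have "stabilizer G \<theta> (\<theta> g y) \<subseteq> stabilizer G \<theta> x"
  proof
    fix h assume "h \<in> stabilizer G \<theta> (\<theta> g y)"
    then have h: "h \<in> carrier G" "\<theta> h (\<theta> g y) = \<theta> g y" by (auto simp: stabilizer_def)
    let ?h = "inv g \<otimes> (h \<otimes> g)"
    have "\<theta> ?h y = \<theta> (inv g) (\<theta> g y)"
      using g h by (simp add: action_mult)
    also have "\<dots> = y" using g by (simp add: action_one flip: action_mult)
    finally have "?h \<in> stabilizer G \<theta> y" using g h by (simp add: stabilizer_def)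
    moreover have "g \<otimes> ?h = h \<otimes> g" using g h(1) by (simp flip: m_assoc)
    then have "h = g \<otimes> ?h \<otimes> inv g" using g h(1) by (simp add: m_assoc)
    ultimately show "h \<in> stabilizer G \<theta> x"
      unfolding stab l_coset_def r_coset_def by blast
  qed
  then have "dim (range (orbit_deriv U \<phi> (\<phi> \<one>) x)) \<le> dim (range (orbit_deriv U \<phi> (\<phi> \<one>) (\<theta> g y)))"
    using linear_orbit_deriv[OF U(1) k p0] orbit_deriv_kernel_mono[OF U k]
    by (intro dim_range_le_if_kernel_le) blast+
  also have "\<dots> \<le> dim (range (orbit_deriv U \<phi> (\<phi> \<one>) y))"
    by (rule rank_orbit_deriv_translate_le[OF U g k])
  finally show ?thesis .
qed

section \<open>Normality of subgradients to the orbits\<close>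

lemma orbit_tangent_eq_range_orbit_deriv:
  assumes k: "1 \<le> k"
  obtains U \<phi> where "(U, \<phi>) \<in> A" "\<one> \<in> U"
    "\<And>x. orbit_tangent G A \<theta> x = range (orbit_deriv U \<phi> (\<phi> \<one>) x)"
proof -
  obtain U \<phi> where c: "chart_at A \<one> = (U, \<phi>)"
    by (cases "chart_at A \<one>")
  have "\<one> \<in> (\<Union>c\<in>A. fst c)" using cover topspace by simp
  then have "\<exists>c. c \<in> A \<and> \<one> \<in> fst c" by blast
  then have "chart_at A \<one> \<in> A \<and> \<one> \<in> fst (chart_at A \<one>)"
    unfolding chart_at_def by (rule someI_ex)
  then have U: "(U, \<phi>) \<in> A" "\<one> \<in> U" by (simp_all add: c)
  show ?thesis
  proof (rule that[OF U])
    fix x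
    have "orbit_deriv U \<phi> (\<phi> \<one>) x = differential A (\<lambda>g. \<theta> g x) \<one>"
      using frechet_derivative_at[OF orbit_has_derivative[OF U(1) k imageI[OF U(2)], of x]]
      by (simp add: differential_def c o_def)
    then show "orbit_tangent G A \<theta> x = range (orbit_deriv U \<phi> (\<phi> \<one>) x)"
      by (simp add: orbit_tangent_def)
  qed
qed

text \<open>
  Every tangent vector of the orbit of \<open>z\<close> is the velocity of a curve in the orbit, on which \<open>f\<close> is
  constant, so regular subgradients at \<open>z\<close> are normal to it. The tangent vectors belonging to a fixed
  \<open>u\<close> vary continuously with \<open>z\<close>, and normality survives in the limit.
\<close>

lemma subgradient_orthogonal_orbit:
  assumes U: "(U, \<phi>) \<in> A" "\<one> \<in> U" and k: "2 \<le> k"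
    and inv: "\<And>g x. g \<in> carrier G \<Longrightarrow> f (\<theta> g x) = f x"
    and v: "v \<in> subdiff f y \<union> horizon_subdiff f y"
  shows "v \<bullet> orbit_deriv U \<phi> (\<phi> \<one>) y u = 0"
proof (rule limiting_subgradient_orthogonal[OF _ _ v])
  have k1: "1 \<le> k" using k by (rule order_trans[rotated]) simp
  have p0: "\<phi> \<one> \<in> \<phi> ` U" using U(2) by simp
  show "isCont (\<lambda>y. orbit_deriv U \<phi> (\<phi> \<one>) y u) y"
    by (rule orbit_deriv_C1_in_point[OF U(1) k p0]) (rule has_derivative_continuous)
  fix z w assume w: "w \<in> frechet_subdiff f z"
  define c where "c t = \<theta> (inv_into U \<phi> (\<phi> \<one> + t *\<^sub>R u)) z" for t :: real
  have dl: "((\<lambda>t. \<phi> \<one> + t *\<^sub>R u) has_derivative (\<lambda>t. t *\<^sub>R u)) (at 0)"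
    by (auto intro!: derivative_eq_intros)
  show "w \<bullet> orbit_deriv U \<phi> (\<phi> \<one>) z u = 0"
  proof (rule frechet_subdiff_orthogonal_curve[OF w, of c])
    show "c 0 = z" by (simp add: c_def inv_into_chart[OF U] action_one)
    have "((\<lambda>p. \<theta> (inv_into U \<phi> p) z) has_derivative orbit_deriv U \<phi> (\<phi> \<one>) z)
        (at (\<phi> \<one> + 0 *\<^sub>R u))"
      using orbit_has_derivative[OF U(1) k1 p0] by simp
    from diff_chain_at[OF dl this]
    have "(c has_derivative orbit_deriv U \<phi> (\<phi> \<one>) z \<circ> (\<lambda>t. t *\<^sub>R u)) (at 0)"
      by (simp add: o_def c_def[abs_def])
    then show "(c has_vector_derivative orbit_deriv U \<phi> (\<phi> \<one>) z u) (at 0)"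
      by (simp add: has_vector_derivative_def o_def linear_scale[OF linear_orbit_deriv[OF U(1) k1 p0]])
    have "((\<lambda>t. \<phi> \<one> + t *\<^sub>R u) \<longlongrightarrow> \<phi> \<one> + 0 *\<^sub>R u) (at (0::real))"
      by (intro tendsto_intros)
    then have "\<forall>\<^sub>F t in at (0::real). \<phi> \<one> + t *\<^sub>R u \<in> \<phi> ` U"
      using chart_props(3)[OF U(1)] p0 by (intro topological_tendstoD) auto
    then show "\<forall>\<^sub>F t in at (0::real). f (c t) = f z"
    proof eventually_elim
      case (elim t)
      then have "inv_into U \<phi> (\<phi> \<one> + t *\<^sub>R u) \<in> carrier G"
        using chart_props(2)[OF U(1)] by (meson inv_into_into subsetD)
      then show ?case by (simp add: c_def inv)
    qed
  qed
qed

end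

section \<open>The projection estimate\<close>

theorem proposition2:
  fixes k :: enat
    and G :: "('g, 'm) monoid_scheme"
    and T :: "'g topology"
    and A :: "('g, 'e::real_normed_vector) atlas"
    and \<theta> :: "'g \<Rightarrow> real ^ 'n \<Rightarrow> real ^ 'n"
    and f :: "real ^ 'n \<Rightarrow> ereal"
    and xbar :: "real ^ 'n"
  assumes "2 \<le> k"
    and "lie_group_action k G T A \<theta>"
    and "\<And>x. f x \<noteq> -\<infinity>"
    and "\<And>g x. g \<in> carrier G \<Longrightarrow> f (\<theta> g x) = f x"
    and "xbar \<in> eff_dom f"
    and "typical_at G T \<theta> xbar"
  shows "(\<exists>c>0. \<exists>U. open U \<and> xbar \<in> U \<and>
            (\<forall>x \<in> U \<inter> eff_dom f. \<forall>y \<in> U \<inter> subdiff_dom f. \<forall>v \<in> subdiff f y.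
               norm (orth_proj (orbit_tangent G A \<theta> x) v) \<le> c * norm (x - y) * norm v))
       \<and> (\<exists>c>0. \<exists>U. open U \<and> xbar \<in> U \<and>
            (\<forall>x \<in> U \<inter> eff_dom f. \<forall>y \<in> U \<inter> eff_dom f. \<forall>w \<in> horizon_subdiff f y.
               norm (orth_proj (orbit_tangent G A \<theta> x) w) \<le> c * norm (x - y) * norm w))"
proof -
  interpret lie_group_action k G T A \<theta> by fact
  have k1: "1 \<le> k" using assms(1) by (rule order_trans[rotated]) simp
  obtain W \<phi> where W: "(W, \<phi>) \<in> A" "\<one>\<^bsub>G\<^esub> \<in> W"
    and tangent: "\<And>x. orbit_tangent G A \<theta> x = range (orbit_deriv W \<phi> (\<phi> \<one>\<^bsub>G\<^esub>) x)"
    using orbit_tangent_eq_range_orbit_deriv[OF k1] by blast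
  have p0: "\<phi> \<one>\<^bsub>G\<^esub> \<in> \<phi> ` W" using W(2) by simp
  let ?L = "orbit_deriv W \<phi> (\<phi> \<one>\<^bsub>G\<^esub>)"
  have Lip: "\<exists>C d. 0 < d \<and>
      (\<forall>x\<in>ball xbar d. \<forall>y\<in>ball xbar d. norm (?L x u - ?L y u) \<le> C * dist x y)" for u
  proof -
    obtain D where D: "\<And>x. ((\<lambda>x. ?L x u) has_derivative D x) (at x)"
      "\<And>w. continuous_on UNIV (\<lambda>x. D x w)"
      using orbit_deriv_C1_in_point[OF W(1) assms(1) p0] by blast
    obtain C d where "0 < d"
      "\<And>x y. x \<in> ball xbar d \<Longrightarrow> y \<in> ball xbar d \<Longrightarrow> norm (?L x u - ?L y u) \<le> C * norm (x - y)"
      by (rule C1_locally_Lipschitz[OF open_UNIV UNIV_I[of xbar] D]) blast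
    then show ?thesis unfolding dist_norm by blast
  qed
  have "\<forall>\<^sub>F x in nhds xbar. dim (range (?L x)) \<le> dim (range (?L xbar))"
    using conjunct2[OF assms(6)[unfolded typical_at_def]]
    by (rule eventually_mono) (rule rank_le_if_orbit_type_eq[OF W k1])
  then obtain c U where cU: "0 < c" "open U" "xbar \<in> U"
    "\<And>x y v. x \<in> U \<Longrightarrow> y \<in> U \<Longrightarrow> (\<And>u. v \<bullet> ?L y u = 0) \<Longrightarrow>
       norm (orth_proj (range (?L x)) v) \<le> c * dist x y * norm v"
    using orth_proj_Lipschitz_estimate[OF linear_orbit_deriv[OF W(1) k1 p0] Lip] by blast
  have "norm (orth_proj (orbit_tangent G A \<theta> x) v) \<le> c * norm (x - y) * norm v"
    if "x \<in> U" "y \<in> U" "v \<in> subdiff f y \<union> horizon_subdiff f y" for x y v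
    unfolding tangent dist_norm[symmetric]
    using that(1,2) subgradient_orthogonal_orbit[OF W assms(1,4) that(3)] by (rule cU(4))
  with cU(1-3) show ?thesis by (intro conjI exI[of _ c] exI[of _ U]) auto
qed

end
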